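(* Let $k$ be an infinite field, $S=k[x_1,\dots,x_n]$ with the standard grading, and let $M$ be a finitely generated graded $S$-module generated in degree $0$. Let $d\in\mathbb{N}$ with $n+d-1\neq 0$. Then, for a generic linear form $\ell\in S_1$, $$H(M_\ell,d)\le\frac{n-1}{n+d-1}\,H(M,d).$$
   Context: For a graded $S$-module $N$, $H(N,d)=\dim_k N_d$ is its Hilbert function. For a linear form $\ell\in S_1$, $M_\ell=M/\ell M$. A property holds for a generic linear form $\ell$ if there is a non-empty Zariski open set $\mathcal{U}\subseteq S_1$ such that it holds for all $\ell\in\mathcal{U}$. *)

theory Defs
  imports "HOL-Algebra.QuotRing" "Jordan_Normal_Form.VS_Connect" "HOL-Library.Poly_Mapping"
begin

section \<open>The standard graded polynomial ring\<close>

text \<open>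
  A monomial is a finitely supported exponent vector, and a polynomial is a finitely supported
  map from monomials to coefficients; the multiplication of \<^typ>\<open>'a \<Rightarrow>\<^sub>0 'b\<close> is convolution.
  The variables are indexed by \<^typ>\<open>nat\<close>, and \<open>k[x\<^sub>0, \<dots>, x\<^sub>n\<^sub>-\<^sub>1]\<close> is cut out by its carrier, so
  that \<open>n\<close> is an ordinary natural number.
\<close>

type_synonym 'k mpoly = "(nat \<Rightarrow>\<^sub>0 nat) \<Rightarrow>\<^sub>0 'k"

definition poly_ring :: "nat \<Rightarrow> 'k::field mpoly ring" where
  "poly_ring n =
     \<lparr>carrier = {p. \<forall>m \<in> Poly_Mapping.keys p. Poly_Mapping.keys m \<subseteq> {..<n}},
      mult = (*), one = 1, zero = 0, add = (+)\<rparr>"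

definition const_poly :: "'k::field \<Rightarrow> 'k mpoly" where
  "const_poly c = Poly_Mapping.single 0 c"

definition monom_degree :: "(nat \<Rightarrow>\<^sub>0 nat) \<Rightarrow> nat" where
  "monom_degree m = (\<Sum>i \<in> Poly_Mapping.keys m. Poly_Mapping.lookup m i)"

definition homogeneous_part :: "nat \<Rightarrow> nat \<Rightarrow> 'k::field mpoly set" where
  "homogeneous_part n i =
     {p \<in> carrier (poly_ring n). \<forall>m \<in> Poly_Mapping.keys p. monom_degree m = i}"

definition eval_poly_at :: "(nat \<Rightarrow> 'k::field) \<Rightarrow> 'k mpoly \<Rightarrow> 'k" where
  "eval_poly_at a p =
     (\<Sum>m \<in> Poly_Mapping.keys p.
        Poly_Mapping.lookup p m * (\<Prod>i \<in> Poly_Mapping.keys m. a i ^ Poly_Mapping.lookup m i))"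


section \<open>Graded modules and Hilbert functions\<close>

locale graded_module = Module.module "poly_ring n :: 'k::field mpoly ring" M
  for n :: nat and M :: "('k::field mpoly, 'm) module" (structure) +
  fixes gr :: "int \<Rightarrow> 'm set"
  assumes component_subgroup: "additive_subgroup (gr i) M"
    and direct_sum:
      "x \<in> carrier M \<Longrightarrow>
         \<exists>!f. (\<forall>i. f i \<in> gr i) \<and> finite {i. f i \<noteq> \<zero>\<^bsub>M\<^esub>} \<and>
              x = (\<Oplus>\<^bsub>M\<^esub>i \<in> {i. f i \<noteq> \<zero>\<^bsub>M\<^esub>}. f i)"
    and graded_smult:
      "\<lbrakk>p \<in> homogeneous_part n i; x \<in> gr j\<rbrakk> \<Longrightarrow> p \<odot>\<^bsub>M\<^esub> x \<in> gr (int i + j)"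

definition finitely_generated :: "nat \<Rightarrow> ('k::field mpoly, 'm) module \<Rightarrow> bool" where
  "finitely_generated n M \<longleftrightarrow>
     (\<exists>A. finite A \<and> A \<subseteq> carrier M \<and>
        LinearCombinations.module.span (poly_ring n) M A = carrier M)"

definition generated_in_degree_zero ::
    "nat \<Rightarrow> ('k::field mpoly, 'm) module \<Rightarrow> (int \<Rightarrow> 'm set) \<Rightarrow> bool" where
  "generated_in_degree_zero n M gr \<longleftrightarrow>
     LinearCombinations.module.span (poly_ring n) M (gr 0) = carrier M"

text \<open>
  A graded component as a vector space over the coefficient field (\<^term>\<open>class_ring\<close>).  The fields
  \<open>mult\<close> and \<open>one\<close> of a module record carry no meaning.
\<close>

definition component_space ::
    "('k::field mpoly, 'm) module \<Rightarrow> (int \<Rightarrow> 'm set) \<Rightarrow> int \<Rightarrow> ('k, 'm) module" where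
  "component_space M gr d =
     \<lparr>carrier = gr d, mult = mult M, one = one M, zero = zero M, add = add M,
      smult = (\<lambda>c x. const_poly c \<odot>\<^bsub>M\<^esub> x)\<rparr>"

definition hilbert_function ::
    "('k::field mpoly, 'm) module \<Rightarrow> (int \<Rightarrow> 'm set) \<Rightarrow> int \<Rightarrow> nat" where
  "hilbert_function M gr d =
     vectorspace.dim (class_ring :: 'k ring) (component_space M gr d)"


section \<open>Quotients\<close>

text \<open>
  The counterpart of \<^const>\<open>FactRing\<close> for modules.  For a submodule \<open>N\<close>, the scalar product of \<open>a\<close>
  with \<open>N + x\<close> is \<open>N + a x\<close>.
\<close>

definition quotient_module :: "('a, 'm) module \<Rightarrow> 'm set \<Rightarrow> ('a, 'm set) module" where
  "quotient_module M N =
     \<lparr>carrier = a_rcosets\<^bsub>M\<^esub> N, mult = undefined, one = undefined,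
      zero = N, add = set_add M, smult = (\<lambda>a X. \<Union>x \<in> X. N +>\<^bsub>M\<^esub> (a \<odot>\<^bsub>M\<^esub> x))\<rparr>"

definition quotient_grading ::
    "('a, 'm) module \<Rightarrow> 'm set \<Rightarrow> (int \<Rightarrow> 'm set) \<Rightarrow> int \<Rightarrow> 'm set set" where
  "quotient_grading M N gr i = (\<lambda>x. N +>\<^bsub>M\<^esub> x) ` gr i"

definition multiples :: "('a, 'm) module \<Rightarrow> 'a \<Rightarrow> 'm set" where
  "multiples M a = (\<lambda>x. a \<odot>\<^bsub>M\<^esub> x) ` carrier M"


section \<open>Generic linear forms\<close>

text \<open>
  The space of linear forms is identified with affine \<open>n\<close>-space by the coefficients of the
  variables.  A Zariski open set is the complement of the common zero locus of an arbitrary set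
  of polynomials in these coefficients.
\<close>

definition linear_form_coeffs :: "'k::field mpoly \<Rightarrow> nat \<Rightarrow> 'k" where
  "linear_form_coeffs l i = Poly_Mapping.lookup l (Poly_Mapping.single i 1)"

definition zariski_open_linear_forms :: "nat \<Rightarrow> 'k::field mpoly set \<Rightarrow> bool" where
  "zariski_open_linear_forms n U \<longleftrightarrow>
     (\<exists>F \<subseteq> carrier (poly_ring n).
        U = {l \<in> homogeneous_part n 1. \<exists>f \<in> F. eval_poly_at (linear_form_coeffs l) f \<noteq> 0})"

definition for_generic_linear_form :: "nat \<Rightarrow> ('k::field mpoly \<Rightarrow> bool) \<Rightarrow> bool" where
  "for_generic_linear_form n P \<longleftrightarrow>
     (\<exists>U. zariski_open_linear_forms n U \<and> U \<noteq> {} \<and> (\<forall>l \<in> U. P l))"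

end

theory Submission
  imports Defs
begin

text \<open>
  Put \<open>N = n + d - 1\<close> and choose \<open>N\<close> distinct scalars \<open>t\<close>.  Any \<open>n\<close> of the linear forms
  \<open>l\<^sub>t = \<Sum>\<^sub>i t\<^sup>i x\<^sub>i\<close> span \<open>S\<^sub>1\<close> (Lagrange interpolation), and a product of fewer than \<open>d\<close> of the \<open>N\<close> forms
  leaves at least \<open>n\<close> of them unused; so, inductively, the products of \<open>d\<close> distinct forms applied
  to \<open>M\<^sub>0\<close> span \<open>M\<^sub>d\<close>.  Choose a basis of \<open>M\<^sub>d\<close> among these vectors.  Each basis vector lies in
  \<open>l\<^sub>t M\<^sub>d\<^sub>-\<^sub>1\<close> for \<open>d\<close> of the \<open>N\<close> values of \<open>t\<close>, so some \<open>l\<^sub>t M\<^sub>d\<^sub>-\<^sub>1\<close> contains at least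
  \<open>(d / N) dim M\<^sub>d\<close> of them.  Since the rank of \<open>l : M\<^sub>d\<^sub>-\<^sub>1 \<rightarrow> M\<^sub>d\<close> is lower semicontinuous in \<open>l\<close>, the
  same lower bound holds for generic \<open>l\<close>.
\<close>

section \<open>Polynomials as functions\<close>

lemma poly_mapping_sum_singles:
  fixes p :: "'a \<Rightarrow>\<^sub>0 'b::comm_monoid_add"
  shows "p = (\<Sum>m\<in>Poly_Mapping.keys p. Poly_Mapping.single m (Poly_Mapping.lookup p m))"
proof (rule poly_mapping_eqI)
  fix k
  have "Poly_Mapping.lookup (\<Sum>m\<in>Poly_Mapping.keys p. Poly_Mapping.single m (Poly_Mapping.lookup p m)) k
    = (\<Sum>m\<in>Poly_Mapping.keys p. if m = k then Poly_Mapping.lookup p m else 0)"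
    by (simp add: lookup_sum lookup_single when_def)
  also have "\<dots> = Poly_Mapping.lookup p k"
    by (simp add: in_keys_iff)
  finally show "Poly_Mapping.lookup p k =
    Poly_Mapping.lookup (\<Sum>m\<in>Poly_Mapping.keys p. Poly_Mapping.single m (Poly_Mapping.lookup p m)) k" ..
qed

lemma poly_ring_simps [simp]:
  "mult (poly_ring n) = (*)" "one (poly_ring n) = 1" "zero (poly_ring n) = 0" "add (poly_ring n) = (+)"
  by (simp_all add: poly_ring_def)

lemma carrier_poly_ring:
  "p \<in> carrier (poly_ring n) \<longleftrightarrow> (\<forall>m \<in> Poly_Mapping.keys p. Poly_Mapping.keys m \<subseteq> {..<n})"
  by (simp add: poly_ring_def)

lemma poly_ring_sum_closed:
  assumes "\<And>i. i \<in> I \<Longrightarrow> p i \<in> carrier (poly_ring n)"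
  shows "sum p I \<in> carrier (poly_ring n)"
  using assms keys_sum[of p I] unfolding carrier_poly_ring by blast

lemma poly_ring_mult_closed:
  assumes "p \<in> carrier (poly_ring n)" "q \<in> carrier (poly_ring n)"
  shows "p * q \<in> carrier (poly_ring n)"
  unfolding carrier_poly_ring
proof
  fix m assume "m \<in> Poly_Mapping.keys (p * q)"
  then obtain a b where "m = a + b" "a \<in> Poly_Mapping.keys p" "b \<in> Poly_Mapping.keys q"
    using keys_mult[of p q] by blast
  with assms show "Poly_Mapping.keys m \<subseteq> {..<n}"
    using Poly_Mapping.keys_add[of a b] unfolding carrier_poly_ring by blast
qed

lemma const_poly_simps:
  "const_poly 0 = 0" "const_poly 1 = 1" "const_poly (a + b) = const_poly a + const_poly b"
  "const_poly (a * b) = const_poly a * const_poly b"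
  by (simp_all add: const_poly_def single_add mult_single)

lemma const_poly_homogeneous: "const_poly c \<in> homogeneous_part n 0"
  by (simp add: const_poly_def homogeneous_part_def carrier_poly_ring monom_degree_def)

lemma homogeneous_part_carrier: "p \<in> homogeneous_part n i \<Longrightarrow> p \<in> carrier (poly_ring n)"
  by (simp add: homogeneous_part_def)

lemma const_poly_carrier: "const_poly c \<in> carrier (poly_ring n)"
  by (rule homogeneous_part_carrier[OF const_poly_homogeneous])

lemma monom_degree_add: "monom_degree (m + m') = monom_degree m + monom_degree m'"
  unfolding monom_degree_def
  by (rule setsum_keys_plus_distrib[where f = "\<lambda>_ x. x"]) auto

lemma monom_degree_single [simp]: "monom_degree (Poly_Mapping.single i e) = e"
  by (simp add: monom_degree_def)

lemma homogeneous_part_mult: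
  assumes "p \<in> homogeneous_part n i" "q \<in> homogeneous_part n j"
  shows "p * q \<in> homogeneous_part n (i + j)"
proof -
  have "monom_degree m = i + j" if m: "m \<in> Poly_Mapping.keys (p * q)" for m
  proof -
    obtain a b where "m = a + b" "a \<in> Poly_Mapping.keys p" "b \<in> Poly_Mapping.keys q"
      using m keys_mult[of p q] by blast
    with assms show ?thesis by (simp add: homogeneous_part_def monom_degree_add)
  qed
  with assms show ?thesis
    by (simp add: homogeneous_part_def poly_ring_mult_closed)
qed

lemma homogeneous_part_sum:
  assumes "\<And>i. i \<in> I \<Longrightarrow> p i \<in> homogeneous_part n j"
  shows "sum p I \<in> homogeneous_part n j"
  using assms keys_sum[of p I] poly_ring_sum_closed[of I p n]
  unfolding homogeneous_part_def by blast

lemma homogeneous_part_prod: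
  assumes "finite I" "\<And>i. i \<in> I \<Longrightarrow> p i \<in> homogeneous_part n 1"
  shows "prod p I \<in> homogeneous_part n (card I)"
  using assms
proof (induction I rule: finite_induct)
  case empty
  then show ?case using const_poly_homogeneous[of 1 n] by (simp add: const_poly_simps)
next
  case (insert i I)
  then show ?case using homogeneous_part_mult[of "p i" n 1 "prod p I" "card I"] by simp
qed

section \<open>Linear forms and their coefficient vectors\<close>

lemma single_one_eq_iff [simp]:
  "Poly_Mapping.single i (Suc 0) = Poly_Mapping.single j (Suc 0) \<longleftrightarrow> i = j"
proof
  assume "Poly_Mapping.single i (Suc 0) = Poly_Mapping.single j (Suc 0)"
  then have "Poly_Mapping.keys (Poly_Mapping.single i (Suc 0)) = Poly_Mapping.keys (Poly_Mapping.single j (Suc 0))"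
    by simp
  then show "i = j" by simp
qed simp

text \<open>Inverts \<open>linear_form_coeffs\<close> on \<open>homogeneous_part n 1\<close>, so
  that a linear form can be treated as a point of affine space. Only the first \<open>n\<close>
  entries of \<open>a\<close> enter.\<close>

definition linear_form :: "nat \<Rightarrow> (nat \<Rightarrow> 'k::field) \<Rightarrow> 'k mpoly" where
  "linear_form n a = (\<Sum>i<n. Poly_Mapping.single (Poly_Mapping.single i 1) (a i))"

lemma single_var_homogeneous:
  "i < n \<Longrightarrow> Poly_Mapping.single (Poly_Mapping.single i 1) c \<in> homogeneous_part n 1"
  by (auto simp: homogeneous_part_def carrier_poly_ring)

lemma linear_form_homogeneous: "linear_form n a \<in> homogeneous_part n 1"
  unfolding linear_form_def by (rule homogeneous_part_sum) (simp add: single_var_homogeneous del: One_nat_def)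

text \<open>Peels one variable off a monomial. The variable and the cofactor keep their support
  inside that of \<open>m\<close>, so a bound on the variables survives an induction on the
  degree.\<close>

lemma monom_degree_SucD:
  assumes "monom_degree m = Suc j"
  obtains i m' where "i \<in> Poly_Mapping.keys m" "Poly_Mapping.keys m' \<subseteq> Poly_Mapping.keys m"
    "m = Poly_Mapping.single i 1 + m'" "monom_degree m' = j"
proof -
  have "Poly_Mapping.keys m \<noteq> {}" using assms by (auto simp: monom_degree_def)
  then obtain i where i: "i \<in> Poly_Mapping.keys m" by blast
  define m' where "m' = m - Poly_Mapping.single i 1"
  have eq: "m = Poly_Mapping.single i 1 + m'"
    using i by (intro poly_mapping_eqI) (auto simp: m'_def lookup_add lookup_minus lookup_single when_def in_keys_iff)
  have "Poly_Mapping.keys m' \<subseteq> Poly_Mapping.keys m"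
    by (auto simp: m'_def in_keys_iff lookup_minus)
  moreover have "monom_degree m' = j"
    using assms eq monom_degree_add[of "Poly_Mapping.single i 1" m'] by simp
  ultimately show ?thesis using that i eq by blast
qed

lemma monom_degree_1D:
  assumes "monom_degree m = 1"
  shows "\<exists>i \<in> Poly_Mapping.keys m. m = Poly_Mapping.single i 1"
proof -
  from assms obtain i m' where *: "i \<in> Poly_Mapping.keys m" "m = Poly_Mapping.single i 1 + m'" "monom_degree m' = 0"
    using monom_degree_SucD[of m 0] by (metis One_nat_def)
  then have "m' = 0"
    by (intro poly_mapping_eqI) (auto simp: monom_degree_def in_keys_iff)
  with * show ?thesis by auto
qed

text \<open>A monomial of degree one in the first \<open>n\<close> variables is a single variable,
  so both sides agree at every monomial.\<close>

lemma linear_form_of_coeffs: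
  assumes "l \<in> homogeneous_part n 1"
  shows "linear_form n (linear_form_coeffs l) = l"
proof (rule poly_mapping_eqI)
  fix m
  show "Poly_Mapping.lookup (linear_form n (linear_form_coeffs l)) m = Poly_Mapping.lookup l m"
  proof (cases "m \<in> (\<lambda>i. Poly_Mapping.single i 1) ` {..<n}")
    case True
    then show ?thesis
      by (auto simp: linear_form_coeffs_def linear_form_def lookup_sum lookup_single when_def)
  next
    case False
    then have "m \<notin> Poly_Mapping.keys l"
      using assms monom_degree_1D[of m] by (fastforce simp: homogeneous_part_def carrier_poly_ring)
    then have "Poly_Mapping.lookup l m = 0" by (simp add: in_keys_iff)
    moreover have "Poly_Mapping.lookup (linear_form n (linear_form_coeffs l)) m = 0"
      using False by (auto simp: linear_form_def lookup_sum lookup_single when_def intro!: sum.neutral)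
    ultimately show ?thesis by simp
  qed
qed

section \<open>Polynomial functions of the coefficients\<close>

text \<open>Closure under sums, products and determinants can be shown for functions, so the
  polynomial that defines the open set never has to be written out.\<close>

definition polynomial_function :: "nat \<Rightarrow> ((nat \<Rightarrow> 'k::field) \<Rightarrow> 'k) \<Rightarrow> bool" where
  "polynomial_function n g \<longleftrightarrow> (\<exists>f \<in> carrier (poly_ring n). \<forall>a. eval_poly_at a f = g a)"

lemma eval_poly_at_add: "eval_poly_at a (p + q) = eval_poly_at a p + eval_poly_at a q"
  unfolding eval_poly_at_def
  by (rule setsum_keys_plus_distrib
      [where f = "\<lambda>m c. c * (\<Prod>i \<in> Poly_Mapping.keys m. a i ^ Poly_Mapping.lookup m i)"])
    (auto simp: algebra_simps)

lemma eval_poly_at_zero: "eval_poly_at a 0 = 0"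
  by (simp add: eval_poly_at_def)

lemma eval_poly_at_sum: "eval_poly_at a (sum p I) = (\<Sum>i\<in>I. eval_poly_at a (p i))"
  by (induction I rule: infinite_finite_induct) (simp_all add: eval_poly_at_zero eval_poly_at_add)

lemma eval_poly_at_single:
  "eval_poly_at a (Poly_Mapping.single m c) = c * (\<Prod>i \<in> Poly_Mapping.keys m. a i ^ Poly_Mapping.lookup m i)"
  by (simp add: eval_poly_at_def)

lemma monomial_value_add:
  fixes a :: "nat \<Rightarrow> 'k::field"
  shows "(\<Prod>i \<in> Poly_Mapping.keys (m + m'). a i ^ Poly_Mapping.lookup (m + m') i) =
   (\<Prod>i \<in> Poly_Mapping.keys m. a i ^ Poly_Mapping.lookup m i) *
   (\<Prod>i \<in> Poly_Mapping.keys m'. a i ^ Poly_Mapping.lookup m' i)"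
proof -
  \<comment> \<open>Over the common support \<open>K\<close> all three products have the same index
    set; the added factors have exponent 0.\<close>
  define K where "K = Poly_Mapping.keys m \<union> Poly_Mapping.keys m'"
  have *: "(\<Prod>i \<in> Poly_Mapping.keys q. a i ^ Poly_Mapping.lookup q i) = (\<Prod>i \<in> K. a i ^ Poly_Mapping.lookup q i)"
    if "Poly_Mapping.keys q \<subseteq> K" for q
    using that by (intro prod.mono_neutral_left) (auto simp: K_def in_keys_iff)
  have "Poly_Mapping.keys (m + m') \<subseteq> K" unfolding K_def by (rule Poly_Mapping.keys_add)
  moreover have "Poly_Mapping.keys m \<subseteq> K" "Poly_Mapping.keys m' \<subseteq> K"
    by (simp_all add: K_def)
  ultimately show ?thesis
    by (simp only: *) (simp only: lookup_add power_add prod.distrib)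
qed

lemma eval_poly_at_mult: "eval_poly_at a (p * q) = eval_poly_at a p * eval_poly_at a q"
proof -
  have "eval_poly_at a (p * q) = eval_poly_at a
     ((\<Sum>m\<in>Poly_Mapping.keys p. Poly_Mapping.single m (Poly_Mapping.lookup p m)) *
      (\<Sum>m\<in>Poly_Mapping.keys q. Poly_Mapping.single m (Poly_Mapping.lookup q m)))"
    using poly_mapping_sum_singles[of p] poly_mapping_sum_singles[of q] by metis
  also have "\<dots> = eval_poly_at a p * eval_poly_at a q"
    by (simp add: sum_product eval_poly_at_sum mult_single eval_poly_at_single monomial_value_add
        eval_poly_at_def[of _ p] eval_poly_at_def[of _ q] mult_ac)
  finally show ?thesis .
qed

lemma polynomial_function_const: "polynomial_function n (\<lambda>_. c)"
  unfolding polynomial_function_def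
  by (rule bexI[of _ "const_poly c"], simp add: const_poly_def eval_poly_at_single) (rule const_poly_carrier)

lemma polynomial_function_var: "i < n \<Longrightarrow> polynomial_function n (\<lambda>a. a i)"
  unfolding polynomial_function_def
  by (rule bexI[of _ "Poly_Mapping.single (Poly_Mapping.single i 1) 1"])
    (simp_all add: eval_poly_at_single carrier_poly_ring)

lemma polynomial_function_mult:
  assumes "polynomial_function n g" "polynomial_function n h"
  shows "polynomial_function n (\<lambda>a. g a * h a)"
  using assms unfolding polynomial_function_def by (metis eval_poly_at_mult poly_ring_mult_closed)

lemma polynomial_function_sum:
  assumes "\<And>i. i \<in> I \<Longrightarrow> polynomial_function n (g i)"
  shows "polynomial_function n (\<lambda>a. \<Sum>i\<in>I. g i a)"
proof -
  from assms obtain p where "\<And>i. i \<in> I \<Longrightarrow> p i \<in> carrier (poly_ring n)"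
    "\<And>i a. i \<in> I \<Longrightarrow> eval_poly_at a (p i) = g i a"
    unfolding polynomial_function_def by metis
  then show ?thesis unfolding polynomial_function_def
    by (intro bexI[of _ "sum p I"]) (simp_all add: eval_poly_at_sum poly_ring_sum_closed)
qed

lemma polynomial_function_prod:
  assumes "\<And>i. i \<in> I \<Longrightarrow> polynomial_function n (g i)"
  shows "polynomial_function n (\<lambda>a. \<Prod>i\<in>I. g i a)"
  using assms
  by (induction I rule: infinite_finite_induct)
    (simp_all add: polynomial_function_const polynomial_function_mult)

lemma polynomial_function_det:
  assumes "\<And>i j. i < r \<Longrightarrow> j < r \<Longrightarrow> polynomial_function n (\<lambda>a. g a i j)"
  shows "polynomial_function n (\<lambda>a. det (mat r r (\<lambda>(i, j). g a i j)))"
proof -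
  \<comment> \<open>The Leibniz formula presents the determinant as a sum of products of entries
    with constant signs, to which the closure rules apply.\<close>
  have eq: "det (mat r r (\<lambda>(i, j). g a i j)) =
     (\<Sum>p \<in> {p. p permutes {0..<r}}. signof p * (\<Prod>i = 0..<r. g a i (p i)))" for a
    by (subst det_def'[of _ r]) (auto intro!: sum.cong prod.cong simp: permutes_in_image)
  show ?thesis unfolding eq
    by (intro polynomial_function_sum polynomial_function_mult polynomial_function_const
        polynomial_function_prod assms) (auto simp: permutes_in_image[of _ "{0..<r}", simplified])
qed

section \<open>Finite-dimensional vector spaces\<close>

text \<open>Sending a coefficient function on \<open>B\<close> to its linear combination is linear
  and bijective, so the inverse is linear as well; \<open>\<phi> b\<close> reads off the entry of
  the inverse at \<open>b\<close>.\<close>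

lemma (in vectorspace) basis_coordinates:
  assumes "finite B" "basis B"
  obtains \<phi> where
    "\<And>b v. b \<in> B \<Longrightarrow> v \<in> carrier V \<Longrightarrow> \<phi> b v \<in> carrier K"
    "\<And>b u v. b \<in> B \<Longrightarrow> u \<in> carrier V \<Longrightarrow> v \<in> carrier V \<Longrightarrow> \<phi> b (u \<oplus>\<^bsub>V\<^esub> v) = \<phi> b u \<oplus>\<^bsub>K\<^esub> \<phi> b v"
    "\<And>b c v. b \<in> B \<Longrightarrow> c \<in> carrier K \<Longrightarrow> v \<in> carrier V \<Longrightarrow> \<phi> b (c \<odot>\<^bsub>V\<^esub> v) = c \<otimes>\<^bsub>K\<^esub> \<phi> b v"
    "\<And>b b'. b \<in> B \<Longrightarrow> b' \<in> B \<Longrightarrow> \<phi> b b' = (if b' = b then \<one>\<^bsub>K\<^esub> else \<zero>\<^bsub>K\<^esub>)"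
proof -
  have BV: "B \<subseteq> carrier V" using assms by (simp add: basis_def)
  interpret lc: linear_map K "func_space B" V "\<lambda>a. lincomb a B"
    by (rule lincomb_is_linear) fact+
  have ex1: "\<exists>!a. a \<in> carrier (func_space B) \<and> lincomb a B = v" if "v \<in> carrier V" for v
    using that assms basis_criterion[OF assms(1) BV] by (simp add: func_space_def)
  define \<psi> where "\<psi> v = (THE a. a \<in> carrier (func_space B) \<and> lincomb a B = v)" for v
  have \<psi>: "\<psi> v \<in> carrier (func_space B)" "lincomb (\<psi> v) B = v" if "v \<in> carrier V" for v
    using theI'[OF ex1[OF that]] by (simp_all add: \<psi>_def)
  have \<psi>_eq: "\<psi> (lincomb a B) = a" if "a \<in> carrier (func_space B)" for a
    using that ex1[of "lincomb a B"] \<psi>[of "lincomb a B"] lc.T_im[OF that] by blast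
  have add: "\<psi> (u \<oplus>\<^bsub>V\<^esub> v) = \<psi> u \<oplus>\<^bsub>func_space B\<^esub> \<psi> v" if "u \<in> carrier V" "v \<in> carrier V" for u v
    using that \<psi> \<psi>_eq[of "\<psi> u \<oplus>\<^bsub>func_space B\<^esub> \<psi> v"] lc.T_add[of "\<psi> u" "\<psi> v"] by simp
  have smult: "\<psi> (c \<odot>\<^bsub>V\<^esub> v) = c \<odot>\<^bsub>func_space B\<^esub> \<psi> v" if "c \<in> carrier K" "v \<in> carrier V" for c v
    using that \<psi> \<psi>_eq[of "c \<odot>\<^bsub>func_space B\<^esub> \<psi> v"] lc.T_smult[of c "\<psi> v"] by simp
  have unit: "\<psi> b' = (\<lambda>b\<in>B. if b' = b then \<one>\<^bsub>K\<^esub> else \<zero>\<^bsub>K\<^esub>)" if b': "b' \<in> B" for b'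
  proof -
    let ?a = "\<lambda>b\<in>B. if b' = b then \<one>\<^bsub>K\<^esub> else \<zero>\<^bsub>K\<^esub>"
    have a: "?a \<in> carrier (func_space B)" by (simp add: func_space_def)
    \<comment> \<open>The term of \<open>b'\<close> is split off; all other coefficients
      vanish.\<close>
    have "lincomb ?a B = ?a b' \<odot>\<^bsub>V\<^esub> b' \<oplus>\<^bsub>V\<^esub> lincomb ?a (B - {b'})"
      by (rule lincomb_del2) (use assms BV b' in auto)
    also have "lincomb ?a (B - {b'}) = \<zero>\<^bsub>V\<^esub>"
      by (rule lincomb_zero) (use BV in auto)
    also have "?a b' \<odot>\<^bsub>V\<^esub> b' \<oplus>\<^bsub>V\<^esub> \<zero>\<^bsub>V\<^esub> = b'"
      using b' BV by (auto simp: subset_iff)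
    finally show ?thesis using \<psi>_eq[OF a] by argo
  qed
  show ?thesis
  proof (rule that[of "\<lambda>b v. \<psi> v b"])
    fix b u v assume "b \<in> B" "u \<in> carrier V" "v \<in> carrier V"
    then show "\<psi> (u \<oplus>\<^bsub>V\<^esub> v) b = \<psi> u b \<oplus>\<^bsub>K\<^esub> \<psi> v b"
      by (simp add: add func_space_def)
  next
    fix b c v assume "b \<in> B" "c \<in> carrier K" "v \<in> carrier V"
    then show "\<psi> (c \<odot>\<^bsub>V\<^esub> v) b = c \<otimes>\<^bsub>K\<^esub> \<psi> v b"
      by (simp add: smult func_space_def)
  next
    fix b v assume "b \<in> B" "v \<in> carrier V"
    then show "\<psi> v b \<in> carrier K" using \<psi>(1)[of v] by (auto simp: func_space_def)
  next
    fix b b' assume "b \<in> B" "b' \<in> B"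
    then show "\<psi> b' b = (if b' = b then \<one>\<^bsub>K\<^esub> else \<zero>\<^bsub>K\<^esub>)" by (simp add: unit)
  qed
qed

text \<open>A generating subset that is minimal under inclusion is a basis. Applied to products of
  linear forms, this makes every basis vector such a product.\<close>

lemma (in vectorspace) finite_gen_set_contains_basis:
  assumes "finite A" "A \<subseteq> carrier V" "gen_set A"
  obtains B where "B \<subseteq> A" "finite B" "basis B"
proof -
  obtain B where B: "B \<subseteq> A" "minimal B (\<lambda>S. S \<subseteq> carrier V \<and> gen_set S)"
    using minimal_exists[of A "\<lambda>S. S \<subseteq> carrier V \<and> gen_set S"] assms by blast
  then show ?thesis
    using that[of B] min_gen_is_basis[of B] finite_subset[OF B(1) assms(1)] by blast
qed

text \<open>Each vector space axiom for \<open>W\<close> is pulled back along the surjection, so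
  \<open>W\<close> may start out as a mere record. This serves the graded components of the quotient
  module.\<close>

lemma vectorspace_surjective_image:
  fixes V :: "('a, 'b, 'c) module_scheme" and W :: "('a, 'd, 'e) module_scheme"
  assumes "vectorspace K V"
    and im: "h ` carrier V = carrier W"
    and add: "\<And>x y. x \<in> carrier V \<Longrightarrow> y \<in> carrier V \<Longrightarrow> h (x \<oplus>\<^bsub>V\<^esub> y) = h x \<oplus>\<^bsub>W\<^esub> h y"
    and smult: "\<And>c x. c \<in> carrier K \<Longrightarrow> x \<in> carrier V \<Longrightarrow> h (c \<odot>\<^bsub>V\<^esub> x) = c \<odot>\<^bsub>W\<^esub> h x"
    and zero: "h \<zero>\<^bsub>V\<^esub> = \<zero>\<^bsub>W\<^esub>"
  shows "linear_map K V W h"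
proof -
  interpret V: vectorspace K V by fact
  have cl: "h x \<in> carrier W" if "x \<in> carrier V" for x using that im by blast
  note simps = add[symmetric] smult[symmetric] zero[symmetric]
  interpret W: vectorspace K W
  proof (rule vs_criteria, goal_cases)
    case 1 show ?case by (rule V.field.field_axioms)
  next
    case 2 show ?case by (simp add: zero[symmetric] cl)
  next
    case 3 show ?case unfolding im[symmetric] by (force simp: simps)
  next
    case 4
    have "h x \<oplus>\<^bsub>W\<^esub> h (\<ominus>\<^bsub>V\<^esub> x) = \<zero>\<^bsub>W\<^esub>" if "x \<in> carrier V" for x
      using that by (simp add: simps V.r_neg)
    then show ?case unfolding im[symmetric] by blast
  next
    case 5 show ?case unfolding im[symmetric] by (force simp: simps)
  next
    case 6 show ?case unfolding im[symmetric] using V.a_comm by (force simp: simps)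
  next
    case 7 show ?case unfolding im[symmetric] using V.a_assoc by (force simp: simps)
  next
    case 8 show ?case unfolding im[symmetric] by (force simp: simps)
  next
    case 9 show ?case unfolding im[symmetric] using V.smult_assoc1 by (force simp: simps)
  next
    case 10 show ?case unfolding im[symmetric] by (force simp: simps)
  next
    case 11 show ?case unfolding im[symmetric] using V.smult_l_distr by (force simp: simps)
  next
    case 12 show ?case unfolding im[symmetric] using V.smult_r_distr by (force simp: simps)
  qed
  show ?thesis
    by (intro linear_map.intro mod_hom.intro mod_hom_axioms.intro V.vectorspace_axioms W.vectorspace_axioms
        V.module_axioms W.module_axioms) (auto simp: LinearCombinations.module_hom_def cl add smult)
qed

text \<open>An inequality form of rank-nullity. Steinitz exchange completes \<open>C\<close> to a
  generating set by a set \<open>D\<close> of at most \<open>V.dim - card C\<close> vectors; as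
  \<open>C\<close> is sent to zero, the images of \<open>D\<close> alone generate
  \<open>W\<close>.\<close>

lemma (in linear_map) dim_surjective_image_le:
  assumes fd: "V.fin_dim" and surj: "T ` carrier V = carrier W"
    and C: "C \<subseteq> carrier V" "V.module.lin_indpt C" "\<And>c. c \<in> C \<Longrightarrow> T c = \<zero>\<^bsub>W\<^esub>"
  shows "W.dim + card C \<le> V.dim"
proof -
  obtain B where B: "finite B" "V.basis B" using V.finite_basis_exists[OF fd] by blast
  then have BV: "B \<subseteq> carrier V" "V.module.gen_set B" by (simp_all add: V.basis_def)
  have finC: "finite C" using V.li_le_dim(1)[OF fd C(1,2)] .
  obtain D where D: "finite D" "D \<subseteq> carrier V" "int (card D) \<le> int (card B) - int (card C)"
      "V.module.gen_set (C \<union> D)"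
    using V.replacement[OF finC B(1) BV(1) C(2)] BV C(1) by auto
  \<comment> \<open>The preimage of the span of the image of \<open>D\<close>. It contains
    \<open>D\<close>, and also \<open>C\<close> because \<open>C\<close> is sent to zero, hence it
    is all of \<open>V\<close>.\<close>
  define N where "N = {v \<in> carrier V. T v \<in> W.module.span (T ` D)}"
  have TD: "T ` D \<subseteq> carrier W" using D(2) by auto
  interpret SW: LinearCombinations.submodule K "W.module.span (T ` D)" W
    by (rule W.module.span_is_submodule[OF TD])
  have "LinearCombinations.submodule K N V"
    by (rule submodule.intro) (auto simp: N_def V.module.module_axioms)
  moreover have "C \<union> D \<subseteq> N"
    using C D(2) W.module.in_own_span[OF TD] by (auto simp: N_def)
  ultimately have "carrier V \<subseteq> N"
    using V.module.span_is_subset[of "C \<union> D" N] D(4) by simp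
  then have "carrier W \<subseteq> W.module.span (T ` D)"
    unfolding surj[symmetric] by (auto simp: N_def)
  then have "W.module.gen_set (T ` D)" using W.module.span_is_subset2[OF TD] by blast
  then have "W.dim \<le> card (T ` D)"
    using D(1) TD by (intro W.gen_ge_dim) auto
  also have "\<dots> \<le> card D" using D(1) by (rule card_image_le)
  finally show ?thesis using D(3) V.dim_basis[OF B] by simp
qed

lemma linear_functional_lincomb:
  fixes V :: "('k::field, 'm) module"
  assumes "vectorspace (class_ring :: 'k ring) V"
    and "\<And>u v. u \<in> carrier V \<Longrightarrow> v \<in> carrier V \<Longrightarrow> \<phi> (u \<oplus>\<^bsub>V\<^esub> v) = (\<phi> u + \<phi> v :: 'k)"
    and "\<And>c v. v \<in> carrier V \<Longrightarrow> \<phi> (c \<odot>\<^bsub>V\<^esub> v) = c * \<phi> v"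
    and "finite C" "C \<subseteq> carrier V"
  shows "\<phi> (LinearCombinations.module.lincomb V a C) = (\<Sum>v\<in>C. a v * \<phi> v)"
proof -
  interpret V: vectorspace class_ring V by fact
  have "\<phi> \<zero>\<^bsub>V\<^esub> = 0" using assms(3)[of "\<zero>\<^bsub>V\<^esub>" 0] by simp
  with assms(4,5) show ?thesis
  proof (induction C rule: finite_induct)
    case empty
    then show ?case by (simp add: V.lincomb_def)
  next
    case (insert x C)
    then have "V.lincomb a (insert x C) = a x \<odot>\<^bsub>V\<^esub> x \<oplus>\<^bsub>V\<^esub> V.lincomb a C"
      by (intro V.lincomb_insert2) auto
    moreover have "V.lincomb a C \<in> carrier V" using insert by (intro V.lincomb_closed) auto
    moreover have "a x \<odot>\<^bsub>V\<^esub> x \<in> carrier V" using insert by (intro V.smult_closed) auto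
    ultimately show ?case using insert by (simp add: assms(2,3))
  qed
qed

text \<open>Lower semicontinuity of rank: the determinant of the coordinate matrix of the moving vectors
  is a polynomial in the parameter.\<close>

lemma linear_independence_open:
  fixes V :: "('k::field, 'm) module" and v :: "(nat \<Rightarrow> 'k) \<Rightarrow> 'm \<Rightarrow> 'm"
  assumes vs: "vectorspace (class_ring :: 'k ring) V"
    and B: "finite B" "vectorspace.basis (class_ring :: 'k ring) V B"
    and C: "C \<subseteq> B" "\<And>b. b \<in> C \<Longrightarrow> v a0 b = b"
    and vV: "\<And>a b. b \<in> C \<Longrightarrow> v a b \<in> carrier V"
    and poly: "\<And>\<phi> b. b \<in> C \<Longrightarrow>
      (\<And>x y. x \<in> carrier V \<Longrightarrow> y \<in> carrier V \<Longrightarrow> \<phi> (x \<oplus>\<^bsub>V\<^esub> y) = (\<phi> x + \<phi> y :: 'k)) \<Longrightarrow>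
      (\<And>c x. x \<in> carrier V \<Longrightarrow> \<phi> (c \<odot>\<^bsub>V\<^esub> x) = c * \<phi> x) \<Longrightarrow> polynomial_function n (\<lambda>a. \<phi> (v a b))"
  obtains f where "f \<in> carrier (poly_ring n)" "eval_poly_at a0 f \<noteq> 0"
    "\<And>a. eval_poly_at a f \<noteq> 0 \<Longrightarrow> inj_on (v a) C \<and>
       \<not> LinearCombinations.module.lin_dep (class_ring :: 'k ring) V (v a ` C)"
proof -
  interpret V: vectorspace class_ring V by fact
  obtain \<phi> where \<phi>0:
    "\<And>b v. b \<in> B \<Longrightarrow> v \<in> carrier V \<Longrightarrow> \<phi> b v \<in> carrier (class_ring :: 'k ring)"
    "\<And>b u v. b \<in> B \<Longrightarrow> u \<in> carrier V \<Longrightarrow> v \<in> carrier V \<Longrightarrow> \<phi> b (u \<oplus>\<^bsub>V\<^esub> v) = \<phi> b u \<oplus>\<^bsub>class_ring\<^esub> \<phi> b v"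
    "\<And>b c v. b \<in> B \<Longrightarrow> c \<in> carrier class_ring \<Longrightarrow> v \<in> carrier V \<Longrightarrow> \<phi> b (c \<odot>\<^bsub>V\<^esub> v) = c \<otimes>\<^bsub>class_ring\<^esub> \<phi> b v"
    "\<And>b b'. b \<in> B \<Longrightarrow> b' \<in> B \<Longrightarrow> \<phi> b b' = (if b' = b then \<one>\<^bsub>class_ring\<^esub> else \<zero>\<^bsub>class_ring\<^esub>)"
    proof (rule V.basis_coordinates[OF B], goal_cases)
    case (1 \<phi>)
    show ?case by (rule 1(1)) (rule 1(2-5); assumption)+
  qed
  have \<phi>: "\<And>b u v. b \<in> B \<Longrightarrow> u \<in> carrier V \<Longrightarrow> v \<in> carrier V \<Longrightarrow> \<phi> b (u \<oplus>\<^bsub>V\<^esub> v) = \<phi> b u + \<phi> b v"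
    "\<And>b c v. b \<in> B \<Longrightarrow> v \<in> carrier V \<Longrightarrow> \<phi> b (c \<odot>\<^bsub>V\<^esub> v) = c * \<phi> b v"
    "\<And>b b'. b \<in> B \<Longrightarrow> b' \<in> B \<Longrightarrow> \<phi> b b' = (if b' = b then 1 else 0)"
    by (simp_all add: \<phi>0)
  define r where "r = card C"
  have finC: "finite C" using C(1) B(1) by (rule finite_subset)
  obtain e where e: "bij_betw e {0..<r} C"
    using ex_bij_betw_nat_finite[OF finC] r_def by blast
  then have eC: "e i \<in> C" if "i < r" for i using that by (auto simp: bij_betw_def)
  then have eB: "e i \<in> B" if "i < r" for i using that C(1) by blast
  \<comment> \<open>Only the coordinates along \<open>C\<close> are kept. This is a square minor of
    the coordinate matrix, and its nonvanishing is enough for independence.\<close>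
  define A where "A a = mat r r (\<lambda>(i, j). \<phi> (e i) (v a (e j)))" for a
  have Adim: "A a \<in> carrier_mat r r" for a by (simp add: A_def)
  have "polynomial_function n (\<lambda>a. det (A a))"
    unfolding A_def by (intro polynomial_function_det poly) (simp_all add: eC eB \<phi>(1,2))
  then obtain f where f: "f \<in> carrier (poly_ring n)" "\<And>a. eval_poly_at a f = det (A a)"
    unfolding polynomial_function_def by blast
  \<comment> \<open>At \<open>a0\<close> the moving vectors are the basis vectors in
    \<open>C\<close> themselves.\<close>
  have "A a0 = 1\<^sub>m r"
  proof (rule eq_matI)
    fix i j assume ij: "i < dim_row (1\<^sub>m r)" "j < dim_col (1\<^sub>m r)"
    then have "e j = e i \<longleftrightarrow> i = j" using e by (auto simp: bij_betw_def inj_on_def)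
    then show "A a0 $$ (i, j) = 1\<^sub>m r $$ (i, j)"
      using ij eC C by (auto simp: A_def subset_iff \<phi>(3))
  qed (simp_all add: A_def)
  then have "eval_poly_at a0 f \<noteq> 0" by (simp add: f)
  moreover have "inj_on (v a) C \<and> V.lin_indpt (v a ` C)" if a: "eval_poly_at a f \<noteq> 0" for a
  proof -
    have det: "det (A a) \<noteq> 0" using a f by simp
    \<comment> \<open>The coefficients are indexed by \<open>C\<close> and not by the image of
      \<open>C\<close>, so this one claim yields both the injectivity of \<open>v a\<close> and the
      independence of the image.\<close>
    have key: "c b = 0" if c: "\<And>b'. b' \<in> B \<Longrightarrow> (\<Sum>x\<in>C. c x * \<phi> b' (v a x)) = 0" and b: "b \<in> C" for c b
    proof -
      define w where "w = vec r (\<lambda>i. c (e i))"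
      have "A a *\<^sub>v w = 0\<^sub>v r"
      proof (rule eq_vecI)
        fix i assume "i < dim_vec (0\<^sub>v r)"
        then have i: "i < r" by simp
        have "(A a *\<^sub>v w) $ i = (\<Sum>j = 0..<r. \<phi> (e i) (v a (e j)) * c (e j))"
          using i by (simp add: A_def w_def scalar_prod_def)
        also have "\<dots> = (\<Sum>x\<in>C. c x * \<phi> (e i) (v a x))"
          using sum.reindex_bij_betw[OF e, of "\<lambda>x. \<phi> (e i) (v a x) * c x"] by (simp add: mult.commute)
        also have "\<dots> = 0" using c[of "e i"] eC[OF i] C by blast
        finally show "(A a *\<^sub>v w) $ i = 0\<^sub>v r $ i" using i by simp
      qed (simp add: A_def)
      moreover have "w \<in> carrier_vec r" by (simp add: w_def)
      ultimately have "w = 0\<^sub>v r"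
        using det det_0_iff_vec_prod_zero_field[OF Adim, of a] by blast
      moreover obtain i where "i < r" "e i = b" using b e by (auto simp: bij_betw_def)
      ultimately show ?thesis by (auto simp: w_def vec_eq_iff)
    qed
    have inj: "inj_on (v a) C"
    proof (rule inj_onI, rule ccontr)
      fix x y assume xy: "x \<in> C" "y \<in> C" "v a x = v a y" "x \<noteq> y"
      \<comment> \<open>The coefficients of the relation \<open>v a x - v a y = 0\<close>, which is
        nontrivial because \<open>x\<close> and \<open>y\<close> differ.\<close>
      define c where "c z = (if z = x then 1 else if z = y then - 1 else 0 :: 'k)" for z
      have "(\<Sum>z\<in>C. c z * \<phi> b (v a z)) = 0" for b
      proof -
        have "(\<Sum>z\<in>C. c z * \<phi> b (v a z)) = (\<Sum>z\<in>{x,y}. c z * \<phi> b (v a z))"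
          using xy finC by (intro sum.mono_neutral_right) (auto simp: c_def)
        also have "\<dots> = 0" using xy by (simp add: c_def)
        finally show ?thesis .
      qed
      from key[OF this xy(1)] show False by (simp add: c_def)
    qed
    moreover have "V.lin_indpt (v a ` C)"
    proof (rule V.finite_lin_indpt2)
      fix c assume c: "V.lincomb c (v a ` C) = \<zero>\<^bsub>V\<^esub>"
      have "(\<Sum>x\<in>C. c (v a x) * \<phi> b (v a x)) = 0" if b: "b \<in> B" for b
      proof -
        have "\<phi> b (V.lincomb c (v a ` C)) = (\<Sum>x\<in>v a ` C. c x * \<phi> b x)"
          by (rule linear_functional_lincomb[OF vs]) (use b \<phi> finC vV in auto)
        moreover have "\<phi> b \<zero>\<^bsub>V\<^esub> = 0" using \<phi>(2)[OF b, of "\<zero>\<^bsub>V\<^esub>" 0] by simp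
        ultimately show ?thesis using c by (simp add: sum.reindex[OF inj])
      qed
      from key[of "\<lambda>x. c (v a x)", OF this] show "\<forall>w\<in>v a ` C. c w = \<zero>\<^bsub>class_ring\<^esub>" by auto
    qed (simp_all add: finC vV image_subset_iff)
    ultimately show ?thesis ..
  qed
  ultimately show ?thesis using that f by blast
qed

section \<open>Generators of the graded components\<close>

context graded_module
begin

lemma component_closed: "x \<in> gr (int i) \<Longrightarrow> x \<in> carrier M"
  using additive_subgroup.a_subset[OF component_subgroup] by blast

lemma component_zero: "\<zero>\<^bsub>M\<^esub> \<in> gr (int i)"
  by (rule additive_subgroup.zero_closed[OF component_subgroup])

lemma component_add: "x \<in> gr (int i) \<Longrightarrow> y \<in> gr (int i) \<Longrightarrow> x \<oplus>\<^bsub>M\<^esub> y \<in> gr (int i)"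
  by (rule additive_subgroup.a_closed[OF component_subgroup])

lemma component_const: "x \<in> gr (int i) \<Longrightarrow> const_poly c \<odot>\<^bsub>M\<^esub> x \<in> gr (int i)"
  using graded_smult[OF const_poly_homogeneous, of x "int i" c] by simp

lemma smult_add_left:
  "p \<in> carrier (poly_ring n) \<Longrightarrow> q \<in> carrier (poly_ring n) \<Longrightarrow> x \<in> carrier M \<Longrightarrow>
    (p + q) \<odot>\<^bsub>M\<^esub> x = p \<odot>\<^bsub>M\<^esub> x \<oplus>\<^bsub>M\<^esub> q \<odot>\<^bsub>M\<^esub> x"
  using smult_l_distr[of p q x] by simp

lemma smult_mult:
  "p \<in> carrier (poly_ring n) \<Longrightarrow> q \<in> carrier (poly_ring n) \<Longrightarrow> x \<in> carrier M \<Longrightarrow>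
    (p * q) \<odot>\<^bsub>M\<^esub> x = p \<odot>\<^bsub>M\<^esub> (q \<odot>\<^bsub>M\<^esub> x)"
  using smult_assoc1[of p q x] by simp

lemma smult_zero_left: "x \<in> carrier M \<Longrightarrow> 0 \<odot>\<^bsub>M\<^esub> x = \<zero>\<^bsub>M\<^esub>"
  using smult_l_null[of x] by simp

lemma smult_one_left: "x \<in> carrier M \<Longrightarrow> 1 \<odot>\<^bsub>M\<^esub> x = x"
  using smult_one[of x] by simp

text \<open>Reduces membership to the summands of a polynomial. It is applied to a span over the
  field, to a graded component, and to a set of finite sums of homogeneous elements.\<close>

lemma smult_sum_left_mem:
  assumes "\<zero>\<^bsub>M\<^esub> \<in> W" "\<And>u v. u \<in> W \<Longrightarrow> v \<in> W \<Longrightarrow> u \<oplus>\<^bsub>M\<^esub> v \<in> W"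
    and "finite I" "y \<in> carrier M" "\<And>i. i \<in> I \<Longrightarrow> p i \<in> carrier (poly_ring n)"
    and "\<And>i. i \<in> I \<Longrightarrow> p i \<odot>\<^bsub>M\<^esub> y \<in> W"
  shows "sum p I \<odot>\<^bsub>M\<^esub> y \<in> W"
  using assms(3,5,6)
proof (induction I rule: finite_induct)
  case empty
  then show ?case using assms by (simp add: smult_zero_left)
next
  case (insert i I)
  then have "sum p (insert i I) \<odot>\<^bsub>M\<^esub> y = p i \<odot>\<^bsub>M\<^esub> y \<oplus>\<^bsub>M\<^esub> sum p I \<odot>\<^bsub>M\<^esub> y"
    using assms(4) by (simp add: smult_add_left poly_ring_sum_closed)
  with insert show ?case by (simp add: assms(2))
qed

text \<open>The locale axiom \<open>component_subgroup\<close> only concerns the degrees \<open>int i\<close>, because its \<open>i\<close>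
  is the natural number \<open>i\<close> of \<open>graded_smult\<close>.  In negative degrees one uses that the zero polynomial
  is homogeneous of every degree.\<close>

lemma zero_mem_component: "\<zero>\<^bsub>M\<^esub> \<in> gr i"
proof (cases "0 \<le> i")
  case True
  then show ?thesis using component_zero[of "nat i"] by simp
next
  case False
  obtain f where "\<forall>i. f i \<in> gr i" using direct_sum[OF M.zero_closed] by blast
  then have f: "f i \<in> gr i" by blast
  have zero: "0 \<in> homogeneous_part n j" for j by (simp add: homogeneous_part_def carrier_poly_ring)
  have "0 \<odot>\<^bsub>M\<^esub> f i \<in> gr (int 0)"
    using graded_smult[OF zero f, of "nat (- i)"] False by simp
  then have "0 \<odot>\<^bsub>M\<^esub> f i \<in> carrier M" by (rule component_closed)
  then have "0 \<odot>\<^bsub>M\<^esub> (0 \<odot>\<^bsub>M\<^esub> f i) = \<zero>\<^bsub>M\<^esub>" by (rule smult_zero_left)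
  then show ?thesis
    using graded_smult[OF zero graded_smult[OF zero f, of 0], of 0] by simp
qed

lemma vectorspace_component:
  "vectorspace (class_ring :: 'k ring) (component_space M gr (int i))"
proof (rule vs_criteria, goal_cases)
  case 1 show ?case by (rule class_field)
next
  case 4
  have "x \<oplus>\<^bsub>M\<^esub> \<ominus>\<^bsub>M\<^esub> x = \<zero>\<^bsub>M\<^esub>" "\<ominus>\<^bsub>M\<^esub> x \<in> gr (int i)" if "x \<in> gr (int i)" for x
    using that component_closed additive_subgroup.a_inv_closed[OF component_subgroup]
    by (simp_all add: M.r_neg)
  then show ?case by (auto simp: component_space_def)
qed (auto simp: component_space_def component_zero component_add component_const component_closed
    const_poly_simps const_poly_carrier M.a_comm M.a_lcomm M.a_assoc smult_mult smult_add_left smult_one_left smult_r_distr)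

lemma component_space_simps [simp]:
  "carrier (component_space M gr i) = gr i"
  "add (component_space M gr i) = add M"
  "zero (component_space M gr i) = \<zero>\<^bsub>M\<^esub>"
  "smult (component_space M gr i) = (\<lambda>c x. const_poly c \<odot>\<^bsub>M\<^esub> x)"
  by (simp_all add: component_space_def)

text \<open>Uniqueness in \<open>direct_sum\<close> is applied to two decompositions of
  \<open>x\<close>: the given one, extended by zero to negative degrees, and the one concentrated in
  degree \<open>d\<close>.\<close>

lemma component_unique:
  assumes "x \<in> gr (int d)" "\<And>j. e j \<in> gr (int j)" "\<And>j. N \<le> j \<Longrightarrow> e j = \<zero>\<^bsub>M\<^esub>"
    and "x = (\<Oplus>\<^bsub>M\<^esub>j\<in>{..<N}. e j)"
  shows "e d = x"
proof -
  define Q where "Q f \<longleftrightarrow> (\<forall>i. f i \<in> gr i) \<and> finite {i. f i \<noteq> \<zero>\<^bsub>M\<^esub>} \<and>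
      x = (\<Oplus>\<^bsub>M\<^esub>i \<in> {i. f i \<noteq> \<zero>\<^bsub>M\<^esub>}. f i)" for f
  have xM: "x \<in> carrier M" by (rule component_closed[OF assms(1)])
  have ex1: "\<exists>!f. Q f" unfolding Q_def by (rule direct_sum[OF xM])
  \<comment> \<open>A sum over any finite \<open>S\<close> containing the support suffices, since
    the extra terms are zero; the exact support need not be determined.\<close>
  have P: "Q f" if f: "\<And>i. f i \<in> gr i" and fM: "\<And>i. f i \<in> carrier M"
    and S: "finite S" "{i. f i \<noteq> \<zero>\<^bsub>M\<^esub>} \<subseteq> S" and x: "x = (\<Oplus>\<^bsub>M\<^esub>i\<in>S. f i)" for f S
  proof -
    have "(\<Oplus>\<^bsub>M\<^esub>i\<in>{i. f i \<noteq> \<zero>\<^bsub>M\<^esub>}. f i) = (\<Oplus>\<^bsub>M\<^esub>i\<in>S. f i)"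
      using S fM by (intro M.add.finprod_mono_neutral_cong_left) blast+
    then show ?thesis using f x finite_subset[OF S(2,1)] unfolding Q_def by metis
  qed
  define f where "f i = (if 0 \<le> i then e (nat i) else \<zero>\<^bsub>M\<^esub>)" for i :: int
  have eM: "e j \<in> carrier M" for j by (rule component_closed[OF assms(2)])
  have Pf: "Q f"
  proof (rule P[of _ "int ` {..<N}"])
    show "{i. f i \<noteq> \<zero>\<^bsub>M\<^esub>} \<subseteq> int ` {..<N}"
    proof
      fix i assume "i \<in> {i. f i \<noteq> \<zero>\<^bsub>M\<^esub>}"
      then have "0 \<le> i" "e (nat i) \<noteq> \<zero>\<^bsub>M\<^esub>" by (simp_all add: f_def split: if_splits)
      moreover from this have "nat i < N" using assms(3)[of "nat i"] by (meson not_le)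
      ultimately have "0 \<le> i" "nat i < N" by blast+
      then show "i \<in> int ` {..<N}" by (intro image_eqI[of _ _ "nat i"]) auto
    qed
    have "(\<Oplus>\<^bsub>M\<^esub>i\<in>int ` {..<N}. f i) = (\<Oplus>\<^bsub>M\<^esub>j\<in>{..<N}. f (int j))"
      by (rule M.finsum_reindex) (auto simp: f_def eM)
    then show "x = (\<Oplus>\<^bsub>M\<^esub>i\<in>int ` {..<N}. f i)" using assms(4) by (simp add: f_def)
    show "f i \<in> gr i" for i
      using assms(2)[of "nat i"] by (auto simp: f_def zero_mem_component)
  qed (auto simp: f_def eM)
  have Pg: "Q (\<lambda>i. if i = int d then x else \<zero>\<^bsub>M\<^esub>)"
  proof (rule P[of _ "{int d}"])
    show "x = (\<Oplus>\<^bsub>M\<^esub>i\<in>{int d}. if i = int d then x else \<zero>\<^bsub>M\<^esub>)" using xM by simp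
    show "(if i = int d then x else \<zero>\<^bsub>M\<^esub>) \<in> gr i" for i
      using assms(1) zero_mem_component[of i] by (cases "i = int d") simp_all
  qed (simp_all add: xM subset_iff)
  have "f = (\<lambda>i. if i = int d then x else \<zero>\<^bsub>M\<^esub>)"
    using ex1 Pf Pg by blast
  then have "f (int d) = x" by simp
  then show ?thesis by (simp add: f_def)
qed

lemma finsum_mem:
  assumes "\<zero>\<^bsub>M\<^esub> \<in> W" "\<And>u v. u \<in> W \<Longrightarrow> v \<in> W \<Longrightarrow> u \<oplus>\<^bsub>M\<^esub> v \<in> W" "W \<subseteq> carrier M"
    and "\<And>i. i \<in> I \<Longrightarrow> f i \<in> W"
  shows "(\<Oplus>\<^bsub>M\<^esub>i\<in>I. f i) \<in> W"
  using assms(4)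
proof (induction I rule: infinite_finite_induct)
  case (insert i I)
  then have "(\<Oplus>\<^bsub>M\<^esub>i\<in>insert i I. f i) = f i \<oplus>\<^bsub>M\<^esub> (\<Oplus>\<^bsub>M\<^esub>i\<in>I. f i)"
    using assms(3) by (intro M.finsum_insert) auto
  with insert show ?case by (simp add: assms(2))
qed (simp_all add: assms(1))

text \<open>Each of the finitely many given generators is a combination of finitely many elements of
  \<open>gr 0\<close>; the union of these finite sets generates \<open>M\<close>.\<close>

lemma finite_degree_zero_generators:
  assumes "finitely_generated n M" "generated_in_degree_zero n M gr"
  obtains B0 where "finite B0" "B0 \<subseteq> gr 0" "span B0 = carrier M"
proof -
  obtain A where A: "finite A" "A \<subseteq> carrier M" "span A = carrier M"
    using assms(1) unfolding finitely_generated_def by blast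
  have "\<forall>a\<in>A. \<exists>B. finite B \<and> B \<subseteq> gr 0 \<and> a \<in> span B"
  proof
    fix a assume "a \<in> A"
    then have "a \<in> span (gr 0)" using A(2) assms(2) unfolding generated_in_degree_zero_def by blast
    then obtain c B where "finite B" "B \<subseteq> gr 0" "a = lincomb c B" "c \<in> B \<rightarrow> carrier (poly_ring n)"
      unfolding span_def by blast
    then show "\<exists>B. finite B \<and> B \<subseteq> gr 0 \<and> a \<in> span B" unfolding span_def by blast
  qed
  then obtain F where F: "\<And>a. a \<in> A \<Longrightarrow> finite (F a) \<and> F a \<subseteq> gr 0 \<and> a \<in> span (F a)" by metis
  define B0 where "B0 = (\<Union>a\<in>A. F a)"
  have B0: "finite B0" "B0 \<subseteq> gr 0" using A(1) F by (auto simp: B0_def)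
  then have B0M: "B0 \<subseteq> carrier M" using component_closed[of _ 0] by auto
  have "a \<in> span B0" if "a \<in> A" for a
    using F[OF that] span_is_monotone[of "F a" B0] that by (auto simp: B0_def)
  then have "span A \<subseteq> span B0"
    by (intro span_is_subset span_is_submodule B0M) auto
  then have "span B0 = carrier M" using A(3) span_is_subset2[OF B0M] by blast
  with that B0 show ?thesis by blast
qed

text \<open>The monomials carry coefficient 1 because these elements serve as generators over the
  field, one degree at a time.\<close>

definition monomial_multiples :: "'m set \<Rightarrow> nat \<Rightarrow> 'm set" where
  "monomial_multiples B j = {Poly_Mapping.single m 1 \<odot>\<^bsub>M\<^esub> b | m b.
     b \<in> B \<and> Poly_Mapping.keys m \<subseteq> {..<n} \<and> monom_degree m = j}"

lemma monomial_homogeneous: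
  "Poly_Mapping.keys m \<subseteq> {..<n} \<Longrightarrow> Poly_Mapping.single m c \<in> homogeneous_part n (monom_degree m)"
  by (simp add: homogeneous_part_def carrier_poly_ring)

lemma monomial_multiples_component:
  assumes "B \<subseteq> gr 0"
  shows "monomial_multiples B j \<subseteq> gr (int j)"
proof
  fix y assume "y \<in> monomial_multiples B j"
  then obtain m b where "y = Poly_Mapping.single m 1 \<odot>\<^bsub>M\<^esub> b" "b \<in> gr 0"
    "Poly_Mapping.single m (1::'k) \<in> homogeneous_part n j"
    using assms monomial_homogeneous[of _ 1] unfolding monomial_multiples_def by blast
  then show "y \<in> gr (int j)" using graded_smult[of _ j b 0] by simp
qed

text \<open>Expanding polynomial coefficients into monomials writes every element of
  \<open>M\<close> as a finite sum of elements of the spans \<open>E j\<close>, one for each degree.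
  If \<open>x\<close> is homogeneous of degree \<open>d\<close>, uniqueness of components identifies
  its summand in \<open>E d\<close> with \<open>x\<close>.\<close>

lemma component_span_monomial_multiples:
  assumes B: "B \<subseteq> gr 0" "span B = carrier M"
  shows "gr (int d) \<subseteq>
    LinearCombinations.module.span (class_ring :: 'k ring) (component_space M gr (int d)) (monomial_multiples B d)"
proof -
  define E where "E j = LinearCombinations.module.span (class_ring :: 'k ring)
    (component_space M gr (int j)) (monomial_multiples B j)" for j
  have E: "E j \<subseteq> gr (int j)" "\<zero>\<^bsub>M\<^esub> \<in> E j" "monomial_multiples B j \<subseteq> E j"
    "\<And>u v. u \<in> E j \<Longrightarrow> v \<in> E j \<Longrightarrow> u \<oplus>\<^bsub>M\<^esub> v \<in> E j"
    "\<And>c v. v \<in> E j \<Longrightarrow> const_poly c \<odot>\<^bsub>M\<^esub> v \<in> E j" for j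
  proof -
    interpret V: vectorspace class_ring "component_space M gr (int j)" by (rule vectorspace_component)
    have D: "monomial_multiples B j \<subseteq> carrier (component_space M gr (int j))"
      using monomial_multiples_component[OF B(1)] by simp
    interpret S: LinearCombinations.submodule class_ring "E j" "component_space M gr (int j)"
      unfolding E_def by (rule V.span_is_submodule[OF D])
    show "E j \<subseteq> gr (int j)" using S.subset by simp
    show "\<zero>\<^bsub>M\<^esub> \<in> E j" using S.zero_closed by simp
    show "monomial_multiples B j \<subseteq> E j" unfolding E_def by (rule V.in_own_span[OF D])
    show "\<And>u v. u \<in> E j \<Longrightarrow> v \<in> E j \<Longrightarrow> u \<oplus>\<^bsub>M\<^esub> v \<in> E j" using S.m_closed by simp
    show "\<And>c v. v \<in> E j \<Longrightarrow> const_poly c \<odot>\<^bsub>M\<^esub> v \<in> E j" using S.smult_closed by simp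
  qed
  have EM: "x \<in> carrier M" if "x \<in> E j" for x j using that E(1) component_closed by blast
  \<comment> \<open>The bound \<open>N\<close> replaces a finite support by an initial segment of
    the degrees.\<close>
  define W where "W = {x. \<exists>e N. (\<forall>j. e j \<in> E j) \<and> (\<forall>j\<ge>N. e j = \<zero>\<^bsub>M\<^esub>) \<and> x = (\<Oplus>\<^bsub>M\<^esub>j\<in>{..<N}. e j)}"
  have WI: "x \<in> W" if "\<And>j. e j \<in> E j" "\<And>j. N \<le> j \<Longrightarrow> e j = \<zero>\<^bsub>M\<^esub>" "x = (\<Oplus>\<^bsub>M\<^esub>j\<in>{..<N}. e j)" for x e N
    unfolding W_def using that by blast
  have W0: "\<zero>\<^bsub>M\<^esub> \<in> W"
    by (rule WI[of "\<lambda>_. \<zero>\<^bsub>M\<^esub>" 0]) (simp_all add: E(2))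
  have WM: "W \<subseteq> carrier M"
  proof
    fix x assume "x \<in> W"
    then obtain e N where "\<forall>j. e j \<in> E j" "x = (\<Oplus>\<^bsub>M\<^esub>j\<in>{..<N::nat}. e j)" unfolding W_def by blast
    then show "x \<in> carrier M" using EM by (auto intro!: M.finsum_closed)
  qed
  have Wadd: "u \<oplus>\<^bsub>M\<^esub> v \<in> W" if uv: "u \<in> W" "v \<in> W" for u v
  proof -
    from uv obtain e N e' N' where e: "\<forall>j. e j \<in> E j" "\<forall>j\<ge>N. e j = \<zero>\<^bsub>M\<^esub>" "u = (\<Oplus>\<^bsub>M\<^esub>j\<in>{..<N}. e j)"
      and e': "\<forall>j. e' j \<in> E j" "\<forall>j\<ge>N'. e' j = \<zero>\<^bsub>M\<^esub>" "v = (\<Oplus>\<^bsub>M\<^esub>j\<in>{..<N'}. e' j)"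
      unfolding W_def by blast
    \<comment> \<open>Both sums are padded with zeros to a common length and then added degree by
      degree.\<close>
    let ?N = "max N N'"
    have "u = (\<Oplus>\<^bsub>M\<^esub>j\<in>{..<?N}. e j)" unfolding e(3)
      using e(1,2) EM by (intro M.add.finprod_mono_neutral_cong_left) auto
    moreover have "v = (\<Oplus>\<^bsub>M\<^esub>j\<in>{..<?N}. e' j)" unfolding e'(3)
      using e'(1,2) EM by (intro M.add.finprod_mono_neutral_cong_left) auto
    ultimately have "u \<oplus>\<^bsub>M\<^esub> v = (\<Oplus>\<^bsub>M\<^esub>j\<in>{..<?N}. e j) \<oplus>\<^bsub>M\<^esub> (\<Oplus>\<^bsub>M\<^esub>j\<in>{..<?N}. e' j)" by simp
    also have "\<dots> = (\<Oplus>\<^bsub>M\<^esub>j\<in>{..<?N}. e j \<oplus>\<^bsub>M\<^esub> e' j)"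
      using e(1) e'(1) EM by (intro M.finsum_addf[symmetric]) auto
    finally show ?thesis
      by (rule WI[rotated 2]) (use e(1,2) e'(1,2) E(4) in auto)
  qed
  have EW: "x \<in> W" if x: "x \<in> E i" for x i
  proof (rule WI[of "\<lambda>j. if i = j then x else \<zero>\<^bsub>M\<^esub>" "Suc i"])
    have "(\<Oplus>\<^bsub>M\<^esub>j\<in>{..<Suc i}. if i = j then x else \<zero>\<^bsub>M\<^esub>) = x"
      by (rule M.finsum_singleton) (use EM[OF x] in auto)
    then show "x = (\<Oplus>\<^bsub>M\<^esub>j\<in>{..<Suc i}. if i = j then x else \<zero>\<^bsub>M\<^esub>)" ..
  qed (use x E(2) in auto)
  have mono: "Poly_Mapping.single m c \<odot>\<^bsub>M\<^esub> b \<in> W"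
    if b: "b \<in> B" and m: "Poly_Mapping.keys m \<subseteq> {..<n}" for m b c
  proof -
    have bM: "b \<in> carrier M" using b B(1) component_closed[of b 0] by auto
    have "Poly_Mapping.single m c = const_poly c * Poly_Mapping.single m 1"
      by (simp add: const_poly_def mult_single)
    with bM have "Poly_Mapping.single m c \<odot>\<^bsub>M\<^esub> b = const_poly c \<odot>\<^bsub>M\<^esub> (Poly_Mapping.single m 1 \<odot>\<^bsub>M\<^esub> b)"
      using smult_mult[OF const_poly_carrier homogeneous_part_carrier[OF monomial_homogeneous[OF m]] bM]
      by simp
    moreover have "Poly_Mapping.single m 1 \<odot>\<^bsub>M\<^esub> b \<in> E (monom_degree m)"
      using E(3) b m unfolding monomial_multiples_def by blast
    ultimately show ?thesis using EW[OF E(5)[of _ "monom_degree m" c]] by simp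
  qed
  have all: "p \<odot>\<^bsub>M\<^esub> b \<in> W" if b: "b \<in> B" and p: "p \<in> carrier (poly_ring n)" for p b
  proof -
    have "(\<Sum>m\<in>Poly_Mapping.keys p. Poly_Mapping.single m (Poly_Mapping.lookup p m)) \<odot>\<^bsub>M\<^esub> b \<in> W"
    proof (rule smult_sum_left_mem[OF W0 Wadd])
      fix m assume "m \<in> Poly_Mapping.keys p"
      then have m: "Poly_Mapping.keys m \<subseteq> {..<n}" using p by (simp add: carrier_poly_ring)
      show "Poly_Mapping.single m (Poly_Mapping.lookup p m) \<odot>\<^bsub>M\<^esub> b \<in> W" by (rule mono[OF b m])
      show "Poly_Mapping.single m (Poly_Mapping.lookup p m) \<in> carrier (poly_ring n)"
        by (rule homogeneous_part_carrier[OF monomial_homogeneous[OF m]])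
    qed (use b B(1) component_closed[of b 0] in auto)
    then show ?thesis by (simp add: poly_mapping_sum_singles[of p, symmetric])
  qed
  show ?thesis
  proof
    fix x assume x: "x \<in> gr (int d)"
    then have "x \<in> span B" using B component_closed by simp
    then obtain c A where A: "A \<subseteq> B" "c \<in> A \<rightarrow> carrier (poly_ring n)" "x = lincomb c A"
      unfolding span_def by blast
    have "x \<in> W" unfolding A(3) lincomb_def
      by (rule finsum_mem[OF W0 Wadd WM]) (use A(1,2) all in auto)
    then obtain e N where e: "\<forall>j. e j \<in> E j" "\<forall>j\<ge>N. e j = \<zero>\<^bsub>M\<^esub>" "x = (\<Oplus>\<^bsub>M\<^esub>j\<in>{..<N}. e j)"
      unfolding W_def by blast
    have "e d = x"
    proof (rule component_unique[OF x _ _ e(3)])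
      show "e j \<in> gr (int j)" for j using e(1) E(1)[of j] by blast
      show "e j = \<zero>\<^bsub>M\<^esub>" if "N \<le> j" for j using e(2) that by blast
    qed
    then show "x \<in> LinearCombinations.module.span (class_ring :: 'k ring)
        (component_space M gr (int d)) (monomial_multiples B d)"
      using e(1) unfolding E_def by blast
  qed
qed

end

section \<open>Products of linear forms on the moment curve\<close>

lemma linear_form_sum:
  "(\<Sum>t\<in>T. linear_form n (a t)) = linear_form n (\<lambda>i. \<Sum>t\<in>T. a t i)"
proof -
  have "linear_form n (\<lambda>i. \<Sum>t\<in>T. a t i) =
      (\<Sum>i<n. \<Sum>t\<in>T. Poly_Mapping.single (Poly_Mapping.single i 1) (a t i))"
    unfolding linear_form_def
    by (intro sum.cong refl poly_mapping_eqI) (simp add: lookup_sum lookup_single when_def)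
  then show ?thesis by (simp add: linear_form_def sum.swap[of _ T])
qed

lemma const_poly_mult_linear_form:
  "const_poly c * linear_form n a = linear_form n (\<lambda>i. c * a i)"
  by (simp add: const_poly_def linear_form_def sum_distrib_left mult_single)

lemma linear_form_unit:
  assumes "i < n"
  shows "linear_form n (\<lambda>j. if j = i then 1 else 0) = Poly_Mapping.single (Poly_Mapping.single i 1) 1"
proof -
  have "linear_form n (\<lambda>j. if j = i then 1 else 0) =
      (\<Sum>j<n. if j = i then Poly_Mapping.single (Poly_Mapping.single i 1) 1 else 0)"
    unfolding linear_form_def by (intro sum.cong) auto
  then show ?thesis using assms by simp
qed

text \<open>Lagrange interpolation inverts the Vandermonde matrix. The weight \<open>c t\<close> is
  the coefficient of \<open>x^i\<close> in the Lagrange polynomial of the node \<open>t\<close>,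
  since interpolating \<open>x^j\<close> at the \<open>n\<close> nodes returns \<open>x^j\<close>
  for \<open>j < n\<close>.\<close>

lemma interpolation_weights:
  fixes T :: "'k::field set"
  assumes "finite T" "card T = n" "i < n"
  obtains c where "\<And>j. j < n \<Longrightarrow> (\<Sum>t\<in>T. c t * t ^ j) = (if j = i then 1 else 0)"
proof -
  define L where "L t = Polynomial.smult (inverse (\<Prod>s\<in>T - {t}. t - s)) (\<Prod>s\<in>T - {t}. [:- s, 1:])" for t
  have degL: "degree (L t) < n" if "t \<in> T" for t
  proof -
    have "degree (\<Prod>s\<in>T - {t}. [:- s, 1:]) \<le> (\<Sum>s\<in>T - {t}. degree [:- s, 1:])"
      by (rule order.trans[OF degree_prod_sum_le]) (use assms(1) in auto)
    also have "\<dots> = n - 1" using assms that by simp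
    finally show ?thesis using assms(3) unfolding L_def
      by (intro le_less_trans[OF degree_smult_le]) linarith
  qed
  have polyL: "poly (L t) s = (if s = t then 1 else 0)" if "t \<in> T" "s \<in> T" for s t
  proof (cases "s = t")
    case True
    have "(\<Prod>s\<in>T - {t}. t - s) \<noteq> 0" using assms(1) by simp
    then show ?thesis using True by (simp add: L_def poly_prod)
  next
    case False
    then have "(\<Prod>r\<in>T - {t}. s - r) = 0" using assms(1) that by (intro prod_zero) auto
    then show ?thesis using False by (simp add: L_def poly_prod)
  qed
  have "(\<Sum>t\<in>T. coeff (L t) i * t ^ j) = (if j = i then 1 else 0)" if j: "j < n" for j
  proof -
    \<comment> \<open>The interpolation error has degree below \<open>n\<close> but vanishes at all
      \<open>n\<close> nodes, so it is zero.\<close>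
    define p where "p = (\<Sum>t\<in>T. Polynomial.smult (t ^ j) (L t)) - monom 1 j"
    have "degree (\<Sum>t\<in>T. Polynomial.smult (t ^ j) (L t)) \<le> n - 1"
      using degL by (intro degree_sum_le assms(1)) (force intro: order.trans[OF degree_smult_le])
    moreover have "degree (monom (1::'k) j) \<le> n - 1" using j by (simp add: degree_monom_eq)
    ultimately have "degree p \<le> n - 1" unfolding p_def by (rule degree_diff_le)
    moreover have "n \<le> degree p" if "p \<noteq> 0"
    proof -
      have "poly p s = 0" if "s \<in> T" for s
      proof -
        have "poly p s = (\<Sum>t\<in>T. t ^ j * poly (L t) s) - s ^ j"
          by (simp add: p_def poly_sum poly_monom)
        also have "(\<Sum>t\<in>T. t ^ j * poly (L t) s) = (\<Sum>t\<in>T. if t = s then s ^ j else 0)"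
          using that by (intro sum.cong) (auto simp: polyL)
        finally show ?thesis using that assms(1) by simp
      qed
      then have "T \<subseteq> {s. poly p s = 0}" by blast
      then have "card T \<le> card {s. poly p s = 0}" by (rule card_mono[OF poly_roots_finite[OF that]])
      also have "\<dots> \<le> degree p" by (rule card_poly_roots_bound[OF that])
      finally show ?thesis using assms(2) by simp
    qed
    ultimately have "p = 0" using assms(3) by fastforce
    then have "coeff (\<Sum>t\<in>T. Polynomial.smult (t ^ j) (L t)) i = coeff (monom 1 j) i"
      by (simp add: p_def)
    then show ?thesis by (simp add: coeff_sum mult.commute)
  qed
  then show ?thesis by (rule that)
qed

text \<open>The coefficient vector \<open>(1, t, ..., t^(n-1))\<close> is a point of the moment
  curve; forms at \<open>n\<close> distinct parameters are independent by Vandermonde.\<close>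

definition moment_form :: "nat \<Rightarrow> 'k::field \<Rightarrow> 'k mpoly" where
  "moment_form n t = linear_form n (\<lambda>i. t ^ i)"

lemma moment_form_homogeneous: "moment_form n t \<in> homogeneous_part n 1"
  unfolding moment_form_def by (rule linear_form_homogeneous)

lemma moment_forms_span:
  fixes T :: "'k::field set"
  assumes "finite T" "card T = n" "i < n"
  obtains c where "Poly_Mapping.single (Poly_Mapping.single i 1) 1 = (\<Sum>t\<in>T. const_poly (c t) * moment_form n t)"
proof -
  obtain c where c: "\<And>j. j < n \<Longrightarrow> (\<Sum>t\<in>T. c t * t ^ j) = (if j = i then 1 else 0)"
    using interpolation_weights[OF assms] by blast
  have "(\<Sum>t\<in>T. const_poly (c t) * moment_form n t) = linear_form n (\<lambda>j. if j = i then 1 else 0)"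
    unfolding moment_form_def const_poly_mult_linear_form linear_form_sum
    by (simp add: linear_form_def c)
  then show ?thesis using that linear_form_unit[OF assms(3)] by metis
qed

context graded_module
begin

text \<open>No form is repeated in a product. Each element is therefore a multiple of the forms at
  \<open>d\<close> different parameters, which the later count relies on.\<close>

definition moment_products :: "'k set \<Rightarrow> 'm set \<Rightarrow> nat \<Rightarrow> 'm set" where
  "moment_products T B d = {(\<Prod>t\<in>A. moment_form n t) \<odot>\<^bsub>M\<^esub> b | A b. A \<subseteq> T \<and> card A = d \<and> b \<in> B}"

lemma moment_prod_homogeneous:
  "finite A \<Longrightarrow> (\<Prod>t\<in>A. moment_form n t) \<in> homogeneous_part n (card A)"
  by (rule homogeneous_part_prod) (simp_all only: moment_form_homogeneous)

lemma moment_products_component: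
  assumes "finite T" "B \<subseteq> gr 0"
  shows "moment_products T B d \<subseteq> gr (int d)"
proof
  fix y assume "y \<in> moment_products T B d"
  then obtain A b where y: "y = (\<Prod>t\<in>A. moment_form n t) \<odot>\<^bsub>M\<^esub> b" "A \<subseteq> T" "card A = d" "b \<in> gr 0"
    using assms(2) unfolding moment_products_def by blast
  then have "finite A" using assms(1) finite_subset by blast
  from graded_smult[OF moment_prod_homogeneous[OF this] y(4)] y show "y \<in> gr (int d)" by simp
qed

text \<open>Induction on \<open>j\<close>, the number of variables not yet traded for moment forms.
  Each step expresses one variable of the monomial through forms outside \<open>A\<close> and so
  enlarges \<open>A\<close> by one, until \<open>card A = d\<close>.\<close>

lemma moment_product_smult_in_span:
  fixes T :: "'k set"
  assumes B: "B \<subseteq> gr 0" and T: "finite T" "n + d \<le> Suc (card T)"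
    and "A \<subseteq> T" "card A + j = d" "y \<in> monomial_multiples B j"
  shows "(\<Prod>t\<in>A. moment_form n t) \<odot>\<^bsub>M\<^esub> y \<in> LinearCombinations.module.span (class_ring :: 'k ring)
    (component_space M gr (int d)) (moment_products T B d)"
proof -
  interpret V: vectorspace class_ring "component_space M gr (int d)" by (rule vectorspace_component)
  let ?S = "V.span (moment_products T B d)"
  have W: "moment_products T B d \<subseteq> carrier (component_space M gr (int d))"
    using moment_products_component[OF T(1) B] by simp
  interpret S: LinearCombinations.submodule class_ring ?S "component_space M gr (int d)"
    by (rule V.span_is_submodule[OF W])
  have S0: "\<zero>\<^bsub>M\<^esub> \<in> ?S" using S.zero_closed by simp
  have Sadd: "u \<oplus>\<^bsub>M\<^esub> v \<in> ?S" if "u \<in> ?S" "v \<in> ?S" for u v using S.m_closed[OF that] by simp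
  have Ssmult: "const_poly c \<odot>\<^bsub>M\<^esub> u \<in> ?S" if "u \<in> ?S" for c u using S.smult_closed[OF _ that, of c] by simp
  from assms(4-6) show "(\<Prod>t\<in>A. moment_form n t) \<odot>\<^bsub>M\<^esub> y \<in> ?S"
  proof (induction j arbitrary: A y)
    case 0
    then obtain m b where y: "y = Poly_Mapping.single m 1 \<odot>\<^bsub>M\<^esub> b" "b \<in> B" "monom_degree m = 0"
      unfolding monomial_multiples_def by blast
    have "m = 0" using y(3) by (intro poly_mapping_eqI) (auto simp: monom_degree_def in_keys_iff)
    moreover have "b \<in> carrier M" using y(2) B component_closed[of b 0] by auto
    ultimately have "y = b" using y(1) by (simp add: smult_one_left)
    then have "(\<Prod>t\<in>A. moment_form n t) \<odot>\<^bsub>M\<^esub> y \<in> moment_products T B d"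
      using 0 y(2) unfolding moment_products_def by auto
    then show ?case using V.in_own_span[OF W] by blast
  next
    case (Suc j)
    then obtain m b where y: "y = Poly_Mapping.single m 1 \<odot>\<^bsub>M\<^esub> b" "b \<in> B"
      "Poly_Mapping.keys m \<subseteq> {..<n}" "monom_degree m = Suc j"
      unfolding monomial_multiples_def by blast
    obtain i m' where m': "i \<in> Poly_Mapping.keys m" "Poly_Mapping.keys m' \<subseteq> Poly_Mapping.keys m"
      "m = Poly_Mapping.single i 1 + m'" "monom_degree m' = j"
      using monom_degree_SucD[OF y(4)] .
    have i: "i < n" using m'(1) y(3) by blast
    have bM: "b \<in> carrier M" using y(2) B component_closed[of b 0] by auto
    define y' where "y' = Poly_Mapping.single m' 1 \<odot>\<^bsub>M\<^esub> b"
    have y': "y' \<in> monomial_multiples B j"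
      using y(2,3) m' unfolding y'_def monomial_multiples_def by blast
    then have y'M: "y' \<in> carrier M"
      using monomial_multiples_component[OF B] component_closed by blast
    have finA: "finite A" using Suc.prems(1) T(1) by (rule finite_subset)
    have "n \<le> card (T - A)" using Suc.prems(1,2) T finA by (simp add: card_Diff_subset)
    then obtain T' where T': "T' \<subseteq> T - A" "card T' = n" "finite T'"
      using obtain_subset_with_card_n by metis
    obtain c where c: "Poly_Mapping.single (Poly_Mapping.single i 1) 1 = (\<Sum>t\<in>T'. const_poly (c t) * moment_form n t)"
      using moment_forms_span[OF T'(3,2) i] .
    let ?P = "\<lambda>A. \<Prod>t\<in>A. moment_form n t"
    have PA: "?P A \<in> carrier (poly_ring n)"
      by (rule homogeneous_part_carrier[OF moment_prod_homogeneous[OF finA]])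
    have X: "Poly_Mapping.single (Poly_Mapping.single i 1) (1::'k) \<in> carrier (poly_ring n)"
      by (rule homogeneous_part_carrier[OF single_var_homogeneous[OF i]])
    have m'n: "Poly_Mapping.keys m' \<subseteq> {..<n}" using m'(2) y(3) by blast
    have X': "Poly_Mapping.single m' (1::'k) \<in> carrier (poly_ring n)"
      by (rule homogeneous_part_carrier[OF monomial_homogeneous[OF m'n]])
    have "y = Poly_Mapping.single (Poly_Mapping.single i 1) 1 \<odot>\<^bsub>M\<^esub> y'"
      using smult_mult[OF X X' bM] by (simp add: y(1) m'(3) y'_def mult_single)
    then have "?P A \<odot>\<^bsub>M\<^esub> y = (?P A * Poly_Mapping.single (Poly_Mapping.single i 1) 1) \<odot>\<^bsub>M\<^esub> y'"
      using smult_mult[OF PA X y'M] by simp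
    also have "?P A * Poly_Mapping.single (Poly_Mapping.single i 1) 1 = (\<Sum>t\<in>T'. const_poly (c t) * ?P (insert t A))"
      unfolding c sum_distrib_left
    proof (rule sum.cong[OF refl])
      fix t assume "t \<in> T'"
      then have "t \<notin> A" using T'(1) by blast
      then show "?P A * (const_poly (c t) * moment_form n t) = const_poly (c t) * ?P (insert t A)"
        using finA by (simp add: mult_ac)
    qed
    also have "\<dots> \<odot>\<^bsub>M\<^esub> y' \<in> ?S"
    proof (rule smult_sum_left_mem[OF S0 Sadd T'(3) y'M])
      fix t assume t: "t \<in> T'"
      have PtA: "?P (insert t A) \<in> carrier (poly_ring n)"
        using homogeneous_part_carrier[OF moment_prod_homogeneous[of "insert t A"]] finA by simp
      then show "const_poly (c t) * ?P (insert t A) \<in> carrier (poly_ring n)"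
        by (rule poly_ring_mult_closed[OF const_poly_carrier])
      have "insert t A \<subseteq> T" "card (insert t A) + j = d"
        using t T'(1) Suc.prems(1,2) finA by auto
      from Ssmult[OF Suc.IH[OF this y']]
      show "(const_poly (c t) * ?P (insert t A)) \<odot>\<^bsub>M\<^esub> y' \<in> ?S"
        using smult_mult[OF const_poly_carrier PtA y'M] by simp
    qed
    finally show ?case .
  qed
qed

text \<open>With \<open>A\<close> empty, the previous lemma puts all monomial multiples of degree
  \<open>d\<close> into the span, and these already generate the component.\<close>

lemma moment_products_gen_set:
  fixes T :: "'k set"
  assumes B: "B \<subseteq> gr 0" "span B = carrier M" and T: "finite T" "n + d \<le> Suc (card T)"
  shows "LinearCombinations.module.span (class_ring :: 'k ring) (component_space M gr (int d))
    (moment_products T B d) = carrier (component_space M gr (int d))"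
proof -
  interpret V: vectorspace class_ring "component_space M gr (int d)" by (rule vectorspace_component)
  have W: "moment_products T B d \<subseteq> carrier (component_space M gr (int d))"
    using moment_products_component[OF T(1) B(1)] by simp
  have "monomial_multiples B d \<subseteq> V.span (moment_products T B d)"
  proof
    fix y assume y: "y \<in> monomial_multiples B d"
    then have "y \<in> carrier M" using monomial_multiples_component[OF B(1)] component_closed by blast
    then show "y \<in> V.span (moment_products T B d)"
      using moment_product_smult_in_span[OF B(1) T, of "{}" d y] y by (simp add: smult_one_left)
  qed
  then have "V.span (monomial_multiples B d) \<subseteq> V.span (moment_products T B d)"
    by (intro V.span_is_subset V.span_is_submodule[OF W])
  then show ?thesis
    using component_span_monomial_multiples[OF B, of d] V.span_is_subset2[OF W] by simp
qed

lemma finite_moment_products: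
  assumes "finite T" "finite B"
  shows "finite (moment_products T B d)"
proof -
  have "moment_products T B d \<subseteq> (\<lambda>(A, b). (\<Prod>t\<in>A. moment_form n t) \<odot>\<^bsub>M\<^esub> b) ` (Pow T \<times> B)"
    unfolding moment_products_def by auto
  then show ?thesis by (rule finite_subset) (use assms in simp)
qed

lemma additive_smult_sum_left:
  assumes add: "\<And>x y. x \<in> gr (int d) \<Longrightarrow> y \<in> gr (int d) \<Longrightarrow> \<phi> (x \<oplus>\<^bsub>M\<^esub> y) = (\<phi> x + \<phi> y :: 'a::cancel_comm_monoid_add)"
    and "finite I" "m \<in> carrier M" "\<And>i. i \<in> I \<Longrightarrow> p i \<in> carrier (poly_ring n)"
    and "\<And>i. i \<in> I \<Longrightarrow> p i \<odot>\<^bsub>M\<^esub> m \<in> gr (int d)"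
  shows "\<phi> (sum p I \<odot>\<^bsub>M\<^esub> m) = (\<Sum>i\<in>I. \<phi> (p i \<odot>\<^bsub>M\<^esub> m))"
  using assms(2,4,5)
proof (induction I rule: finite_induct)
  case empty
  have "\<phi> \<zero>\<^bsub>M\<^esub> = 0" using add[OF component_zero component_zero] by simp
  then show ?case using assms(3) by (simp add: smult_zero_left)
next
  case (insert i I)
  have "sum p I \<odot>\<^bsub>M\<^esub> m \<in> gr (int d)"
    by (rule smult_sum_left_mem) (use insert assms(3) component_zero component_add in auto)
  moreover have "sum p (insert i I) \<odot>\<^bsub>M\<^esub> m = p i \<odot>\<^bsub>M\<^esub> m \<oplus>\<^bsub>M\<^esub> sum p I \<odot>\<^bsub>M\<^esub> m"
    using insert assms(3) by (simp add: smult_add_left poly_ring_sum_closed)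
  ultimately show ?case using insert by (simp add: add)
qed

end

section \<open>The generic rank\<close>

text \<open>Double counting: there are \<open>d * card B\<close> pairs with
  \<open>t \<in> A b\<close>, so some \<open>t\<close> attains at least the average. The factor
  \<open>card T\<close> keeps the bound free of division.\<close>

lemma average_le_some_count:
  assumes "finite B" "finite T" "T \<noteq> {}" "\<And>b. b \<in> B \<Longrightarrow> A b \<subseteq> T \<and> card (A b) = d"
  obtains t where "t \<in> T" "d * card B \<le> card T * card {b \<in> B. t \<in> A b}"
proof -
  have "(\<Sum>t\<in>T. card {b \<in> B. t \<in> A b}) = (\<Sum>t\<in>T. \<Sum>b\<in>B. if t \<in> A b then 1 else 0)"
    using assms(1) by (simp add: sum.If_cases Int_def)
  also have "\<dots> = (\<Sum>b\<in>B. \<Sum>t\<in>T. if t \<in> A b then 1 else 0)" by (rule sum.swap)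
  also have "\<dots> = (\<Sum>b\<in>B. d)"
  proof (rule sum.cong[OF refl])
    fix b assume "b \<in> B"
    then have "T \<inter> A b = A b" "card (A b) = d" using assms(4) by blast+
    then show "(\<Sum>t\<in>T. if t \<in> A b then 1 else 0) = d"
      using assms(2) by (simp add: sum.If_cases Int_def[symmetric] Collect_mem_eq)
  qed
  finally have total: "(\<Sum>t\<in>T. card {b \<in> B. t \<in> A b}) = d * card B" by simp
  have "\<exists>t\<in>T. d * card B \<le> card T * card {b \<in> B. t \<in> A b}"
  proof (rule ccontr)
    assume "\<not> ?thesis"
    then have "(\<Sum>t\<in>T. card T * card {b \<in> B. t \<in> A b}) < (\<Sum>t\<in>T. d * card B)"
      using assms(2,3) by (intro sum_strict_mono) auto
    then show False by (simp add: total sum_distrib_left[symmetric])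
  qed
  then show ?thesis using that by blast
qed

context graded_module
begin

text \<open>The infinite field supplies enough parameters, and finitely many parameters and
  generators give a finite generating set of moment products.\<close>

lemma component_fin_dim:
  assumes "infinite (UNIV :: 'k set)" "finitely_generated n M" "generated_in_degree_zero n M gr"
  shows "vectorspace.fin_dim (class_ring :: 'k ring) (component_space M gr (int d))"
proof -
  interpret V: vectorspace class_ring "component_space M gr (int d)" by (rule vectorspace_component)
  obtain B where B: "finite B" "B \<subseteq> gr 0" "span B = carrier M"
    using finite_degree_zero_generators[OF assms(2,3)] .
  obtain T :: "'k set" where T: "finite T" "card T = n + d"
    using infinite_arbitrarily_large[OF assms(1)] by metis
  have "V.gen_set (moment_products T B d)"
    by (rule moment_products_gen_set[OF B(2,3) T(1)]) (simp add: T(2))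
  then show ?thesis
    unfolding V.fin_dim_def using finite_moment_products[OF T(1) B(1)] moment_products_component[OF T(1) B(2)]
    by (intro exI[of _ "moment_products T B d"]) simp
qed

text \<open>Here \<open>r\<close> counts the chosen basis vectors that are multiples of one good
  moment form \<open>l0\<close>. The polynomial \<open>f\<close> is a minor that is nonzero at
  \<open>l0\<close>; wherever it does not vanish, \<open>r\<close> independent vectors remain in the
  image of \<open>l\<close>.\<close>

lemma generic_rank:
  assumes "infinite (UNIV :: 'k set)" "finitely_generated n M" "generated_in_degree_zero n M gr" "0 < d"
    and "n + d \<noteq> 1"
  obtains f l0 r where "f \<in> carrier (poly_ring n)" "l0 \<in> homogeneous_part n 1"
    "eval_poly_at (linear_form_coeffs l0) f \<noteq> 0"
    "d * vectorspace.dim (class_ring :: 'k ring) (component_space M gr (int d)) \<le> (n + d - 1) * r"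
    "\<And>l. l \<in> homogeneous_part n 1 \<Longrightarrow> eval_poly_at (linear_form_coeffs l) f \<noteq> 0 \<Longrightarrow>
      \<exists>C \<subseteq> gr (int d). C \<subseteq> multiples M l \<and> card C = r \<and>
        \<not> LinearCombinations.module.lin_dep (class_ring :: 'k ring) (component_space M gr (int d)) C"
proof -
  interpret V: vectorspace class_ring "component_space M gr (int d)" by (rule vectorspace_component)
  obtain B0 where B0: "finite B0" "B0 \<subseteq> gr 0" "span B0 = carrier M"
    using finite_degree_zero_generators[OF assms(2,3)] .
  obtain T :: "'k set" where T: "finite T" "card T = n + d - 1"
    using infinite_arbitrarily_large[OF assms(1)] by metis
  \<comment> \<open>\<open>n + d - 1\<close> is positive because \<open>0 < d\<close> and
    \<open>n + d \<noteq> 1\<close>.\<close>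
  have Tne: "T \<noteq> {}" using T assms(4,5) by auto
  have gen: "V.gen_set (moment_products T B0 d)"
    by (rule moment_products_gen_set[OF B0(2,3) T(1)]) (simp add: T(2))
  have sub: "moment_products T B0 d \<subseteq> carrier (component_space M gr (int d))"
    using moment_products_component[OF T(1) B0(2)] by simp
  obtain B where B: "B \<subseteq> moment_products T B0 d" "finite B" "V.basis B"
    using V.finite_gen_set_contains_basis[OF finite_moment_products[OF T(1) B0(1)] sub gen] .
  have "\<forall>b\<in>B. \<exists>A \<beta>. A \<subseteq> T \<and> card A = d \<and> \<beta> \<in> B0 \<and> b = (\<Prod>t\<in>A. moment_form n t) \<odot>\<^bsub>M\<^esub> \<beta>"
    using B(1) unfolding moment_products_def by blast
  then obtain A \<beta> where A: "\<And>b. b \<in> B \<Longrightarrow> A b \<subseteq> T \<and> card (A b) = d"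
    and \<beta>: "\<And>b. b \<in> B \<Longrightarrow> \<beta> b \<in> B0 \<and> b = (\<Prod>t\<in>A b. moment_form n t) \<odot>\<^bsub>M\<^esub> \<beta> b" by metis
  \<comment> \<open>The form at this \<open>t\<close> is a factor in at least the fraction
    \<open>d / card T\<close> of the basis vectors; \<open>C\<close> collects them.\<close>
  obtain t where t: "t \<in> T" "d * card B \<le> card T * card {b \<in> B. t \<in> A b}"
    using average_le_some_count[OF B(2) T(1) Tne A] .
  define C where "C = {b \<in> B. t \<in> A b}"
  define l0 where "l0 = moment_form n t"
  have l0: "l0 \<in> homogeneous_part n 1" unfolding l0_def by (rule moment_form_homogeneous)
  \<comment> \<open>The cofactor of \<open>l0\<close> in the basis vector \<open>b\<close>, of
    degree \<open>d - 1\<close>.\<close>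
  define \<mu> where "\<mu> b = (\<Prod>s\<in>A b - {t}. moment_form n s) \<odot>\<^bsub>M\<^esub> \<beta> b" for b
  have \<mu>: "\<mu> b \<in> gr (int (d - 1))" "l0 \<odot>\<^bsub>M\<^esub> \<mu> b = b" if b: "b \<in> C" for b
  proof -
    have bB: "b \<in> B" "t \<in> A b" using b by (simp_all add: C_def)
    then have fin: "finite (A b)" using A T(1) finite_subset by blast
    have \<beta>0: "\<beta> b \<in> gr 0" using \<beta>[OF bB(1)] B0(2) by blast
    have hom: "(\<Prod>s\<in>A b - {t}. moment_form n s) \<in> homogeneous_part n (d - 1)"
      using moment_prod_homogeneous[of "A b - {t}"] fin bB A[OF bB(1)] by simp
    show "\<mu> b \<in> gr (int (d - 1))" using graded_smult[OF hom \<beta>0] by (simp add: \<mu>_def)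
    have "l0 \<odot>\<^bsub>M\<^esub> \<mu> b = (l0 * (\<Prod>s\<in>A b - {t}. moment_form n s)) \<odot>\<^bsub>M\<^esub> \<beta> b"
      unfolding \<mu>_def using smult_mult[OF homogeneous_part_carrier[OF l0] homogeneous_part_carrier[OF hom]]
        component_closed[of "\<beta> b" 0] \<beta>0 by simp
    also have "l0 * (\<Prod>s\<in>A b - {t}. moment_form n s) = (\<Prod>s\<in>A b. moment_form n s)"
      unfolding l0_def by (rule prod.remove[OF fin bB(2), symmetric])
    finally show "l0 \<odot>\<^bsub>M\<^esub> \<mu> b = b" using \<beta>[OF bB(1)] by simp
  qed
  have \<mu>M: "\<mu> b \<in> carrier M" if "b \<in> C" for b using \<mu>(1)[OF that] component_closed by blast
  have hom_smult: "p \<odot>\<^bsub>M\<^esub> \<mu> b \<in> gr (int d)" if "p \<in> homogeneous_part n 1" "b \<in> C" for p b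
    using graded_smult[OF that(1) \<mu>(1)[OF that(2)]] assms(4) by simp
  \<comment> \<open>Replacing \<open>l0\<close> by a form with variable coefficients moves the
    vectors of \<open>C\<close>; the coefficients of \<open>l0\<close> give back the basis
    vectors.\<close>
  define v where "v a b = linear_form n a \<odot>\<^bsub>M\<^esub> \<mu> b" for a b
  obtain f where f: "f \<in> carrier (poly_ring n)" "eval_poly_at (linear_form_coeffs l0) f \<noteq> 0"
    "\<And>a. eval_poly_at a f \<noteq> 0 \<Longrightarrow> inj_on (v a) C \<and> V.lin_indpt (v a ` C)"
  proof (rule linear_independence_open[OF vectorspace_component B(2,3), of C v "linear_form_coeffs l0" n])
    show "C \<subseteq> B" by (auto simp: C_def)
    show "v (linear_form_coeffs l0) b = b" if "b \<in> C" for b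
      using \<mu>(2)[OF that] by (simp add: v_def linear_form_of_coeffs[OF l0])
    show "v a b \<in> carrier (component_space M gr (int d))" if "b \<in> C" for a b
      using hom_smult[OF linear_form_homogeneous that] by (simp add: v_def)
  next
    fix \<phi> :: "'m \<Rightarrow> 'k" and b
    assume b: "b \<in> C"
      and add: "\<And>x y. x \<in> carrier (component_space M gr (int d)) \<Longrightarrow> y \<in> carrier (component_space M gr (int d)) \<Longrightarrow>
        \<phi> (x \<oplus>\<^bsub>component_space M gr (int d)\<^esub> y) = \<phi> x + \<phi> y"
      and smult: "\<And>c x. x \<in> carrier (component_space M gr (int d)) \<Longrightarrow>
        \<phi> (c \<odot>\<^bsub>component_space M gr (int d)\<^esub> x) = c * \<phi> x"
    let ?x = "\<lambda>i. Poly_Mapping.single (Poly_Mapping.single i 1) (1::'k)"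
    \<comment> \<open>A linear functional of the moving vector is linear in \<open>a\<close>; its
      coefficients are the values of \<open>\<phi>\<close> on the products of the variables with
      \<open>\<mu> b\<close>.\<close>
    have "\<phi> (v a b) = (\<Sum>i<n. \<phi> (?x i \<odot>\<^bsub>M\<^esub> \<mu> b) * a i)" for a
    proof -
      have "\<phi> (v a b) = (\<Sum>i<n. \<phi> (Poly_Mapping.single (Poly_Mapping.single i 1) (a i) \<odot>\<^bsub>M\<^esub> \<mu> b))"
        unfolding v_def linear_form_def
      proof (rule additive_smult_sum_left)
        show "\<phi> (x \<oplus>\<^bsub>M\<^esub> y) = \<phi> x + \<phi> y" if "x \<in> gr (int d)" "y \<in> gr (int d)" for x y
          using add that by simp
        fix i assume "i \<in> {..<n}"
        then have hom: "Poly_Mapping.single (Poly_Mapping.single i 1) (a i) \<in> homogeneous_part n 1"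
          by (intro single_var_homogeneous) simp
        show "Poly_Mapping.single (Poly_Mapping.single i 1) (a i) \<in> carrier (poly_ring n)"
          by (rule homogeneous_part_carrier[OF hom])
        show "Poly_Mapping.single (Poly_Mapping.single i 1) (a i) \<odot>\<^bsub>M\<^esub> \<mu> b \<in> gr (int d)"
          by (rule hom_smult[OF hom b])
      qed (simp_all add: \<mu>M[OF b])
      also have "\<dots> = (\<Sum>i<n. \<phi> (?x i \<odot>\<^bsub>M\<^esub> \<mu> b) * a i)"
      proof (rule sum.cong[OF refl])
        fix i assume "i \<in> {..<n}"
        then have hom: "?x i \<in> homogeneous_part n 1" by (intro single_var_homogeneous) simp
        have "Poly_Mapping.single (Poly_Mapping.single i 1) (a i) = const_poly (a i) * ?x i"
          by (simp add: const_poly_def mult_single)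
        then have "Poly_Mapping.single (Poly_Mapping.single i 1) (a i) \<odot>\<^bsub>M\<^esub> \<mu> b = const_poly (a i) \<odot>\<^bsub>M\<^esub> (?x i \<odot>\<^bsub>M\<^esub> \<mu> b)"
          using smult_mult[OF const_poly_carrier homogeneous_part_carrier[OF hom] \<mu>M[OF b]] by simp
        then show "\<phi> (Poly_Mapping.single (Poly_Mapping.single i 1) (a i) \<odot>\<^bsub>M\<^esub> \<mu> b) = \<phi> (?x i \<odot>\<^bsub>M\<^esub> \<mu> b) * a i"
          using smult[of "?x i \<odot>\<^bsub>M\<^esub> \<mu> b" "a i"] hom_smult[OF hom b] by (simp add: mult.commute)
      qed
      finally show ?thesis .
    qed
    then show "polynomial_function n (\<lambda>a. \<phi> (v a b))"
      by (simp only:) (intro polynomial_function_sum polynomial_function_mult polynomial_function_const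
          polynomial_function_var, simp)
  qed blast
  show ?thesis
  proof (rule that[OF f(1) l0 f(2)])
    show "d * V.dim \<le> (n + d - 1) * card C"
      using t(2) V.dim_basis[OF B(2,3)] by (simp add: T(2) C_def)
    fix l :: "'k mpoly"
    assume l: "l \<in> homogeneous_part n 1" "eval_poly_at (linear_form_coeffs l) f \<noteq> 0"
    let ?C = "v (linear_form_coeffs l) ` C"
    have v: "v (linear_form_coeffs l) b = l \<odot>\<^bsub>M\<^esub> \<mu> b" for b
      by (simp add: v_def linear_form_of_coeffs[OF l(1)])
    have "?C \<subseteq> gr (int d)" using hom_smult[OF l(1)] by (auto simp: v)
    moreover have "?C \<subseteq> multiples M l" using \<mu>M by (auto simp: v multiples_def)
    moreover have "card ?C = card C" "V.lin_indpt ?C"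
      using f(3)[OF l(2)] by (simp_all add: card_image)
    ultimately show "\<exists>C' \<subseteq> gr (int d). C' \<subseteq> multiples M l \<and> card C' = card C \<and> V.lin_indpt C'" by blast
  qed
qed

section \<open>The quotient by a linear form\<close>

lemma multiples_subgroup:
  assumes "l \<in> carrier (poly_ring n)"
  shows "abelian_subgroup (multiples M l) M"
proof (rule abelian_subgroupI3)
  have "l \<odot>\<^bsub>M\<^esub> x \<oplus>\<^bsub>M\<^esub> l \<odot>\<^bsub>M\<^esub> y \<in> multiples M l" if "x \<in> carrier M" "y \<in> carrier M" for x y
    unfolding multiples_def
    by (rule image_eqI[of _ _ "x \<oplus>\<^bsub>M\<^esub> y"]) (simp_all add: assms that smult_r_distr)
  moreover have "\<zero>\<^bsub>M\<^esub> \<in> multiples M l"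
    unfolding multiples_def by (rule image_eqI[of _ _ "\<zero>\<^bsub>M\<^esub>"]) (simp_all add: assms)
  moreover have "\<ominus>\<^bsub>M\<^esub> (l \<odot>\<^bsub>M\<^esub> x) \<in> multiples M l" if "x \<in> carrier M" for x
    unfolding multiples_def by (rule image_eqI[of _ _ "\<ominus>\<^bsub>M\<^esub> x"]) (simp_all add: assms that smult_r_minus)
  ultimately show "additive_subgroup (multiples M l) M"
    using assms by (intro additive_subgroup.intro M.add.subgroupI)
      (auto simp: multiples_def a_inv_def)
qed (rule M.abelian_group_axioms)

text \<open>\<open>quotient_grading\<close> is an image of \<open>gr\<close>, so the coset map is
  onto by construction and transports the vector space structure. The main check is that scalar
  multiplication, a union over representatives, yields a single coset.\<close>

lemma quotient_component_linear_map:
  assumes l: "l \<in> carrier (poly_ring n)"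
  shows "linear_map (class_ring :: 'k ring) (component_space M gr (int d))
    (component_space (quotient_module M (multiples M l)) (quotient_grading M (multiples M l) gr) (int d))
    (\<lambda>x. multiples M l +>\<^bsub>M\<^esub> x)"
proof -
  interpret N: abelian_subgroup "multiples M l" M by (rule multiples_subgroup[OF l])
  show ?thesis
  proof (rule vectorspace_surjective_image[OF vectorspace_component])
    show "(\<lambda>x. multiples M l +>\<^bsub>M\<^esub> x) ` carrier (component_space M gr (int d)) =
      carrier (component_space (quotient_module M (multiples M l)) (quotient_grading M (multiples M l) gr) (int d))"
      by (simp add: component_space_def quotient_grading_def)
  next
    fix x y assume "x \<in> carrier (component_space M gr (int d))" "y \<in> carrier (component_space M gr (int d))"
    then have "x \<in> carrier M" "y \<in> carrier M" using component_closed by simp_all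
    then show "multiples M l +>\<^bsub>M\<^esub> (x \<oplus>\<^bsub>component_space M gr (int d)\<^esub> y) =
      (multiples M l +>\<^bsub>M\<^esub> x) \<oplus>\<^bsub>component_space (quotient_module M (multiples M l)) (quotient_grading M (multiples M l) gr) (int d)\<^esub>
      (multiples M l +>\<^bsub>M\<^esub> y)"
      by (simp add: component_space_def quotient_module_def N.a_rcos_sum)
  next
    fix c :: 'k and x assume "x \<in> carrier (component_space M gr (int d))"
    then have x: "x \<in> carrier M" using component_closed by simp
    \<comment> \<open>Two representatives differ by a multiple of \<open>l\<close>, and constants
      commute with \<open>l\<close>, so all of them lead to the same coset.\<close>
    have "multiples M l +>\<^bsub>M\<^esub> (const_poly c \<odot>\<^bsub>M\<^esub> y) = multiples M l +>\<^bsub>M\<^esub> (const_poly c \<odot>\<^bsub>M\<^esub> x)"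
      if y: "y \<in> multiples M l +>\<^bsub>M\<^esub> x" for y
    proof -
      obtain z where z: "z \<in> carrier M" "y = l \<odot>\<^bsub>M\<^esub> z \<oplus>\<^bsub>M\<^esub> x"
        using y by (auto simp: a_r_coset_def' multiples_def)
      have "const_poly c \<odot>\<^bsub>M\<^esub> (l \<odot>\<^bsub>M\<^esub> z) = l \<odot>\<^bsub>M\<^esub> (const_poly c \<odot>\<^bsub>M\<^esub> z)"
        using smult_mult[OF const_poly_carrier l z(1), of c] smult_mult[OF l const_poly_carrier z(1), of c]
        by (simp add: mult.commute)
      then have "const_poly c \<odot>\<^bsub>M\<^esub> y = l \<odot>\<^bsub>M\<^esub> (const_poly c \<odot>\<^bsub>M\<^esub> z) \<oplus>\<^bsub>M\<^esub> const_poly c \<odot>\<^bsub>M\<^esub> x"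
        using z x l by (simp add: smult_r_distr const_poly_carrier)
      then have "const_poly c \<odot>\<^bsub>M\<^esub> y \<in> multiples M l +>\<^bsub>M\<^esub> (const_poly c \<odot>\<^bsub>M\<^esub> x)"
        using z(1) const_poly_carrier[of c] by (auto simp: a_r_coset_def' multiples_def)
      then show ?thesis
        using x const_poly_carrier[of c] N.a_repr_independence'[of "const_poly c \<odot>\<^bsub>M\<^esub> y" "const_poly c \<odot>\<^bsub>M\<^esub> x"] by simp
    qed
    \<comment> \<open>A coset is nonempty, so the union below equals the common coset.\<close>
    moreover have "x \<in> multiples M l +>\<^bsub>M\<^esub> x" using x by (rule N.a_rcos_self)
    ultimately have "(\<Union>y\<in>multiples M l +>\<^bsub>M\<^esub> x. multiples M l +>\<^bsub>M\<^esub> (const_poly c \<odot>\<^bsub>M\<^esub> y)) =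
        multiples M l +>\<^bsub>M\<^esub> (const_poly c \<odot>\<^bsub>M\<^esub> x)" by blast
    then show "multiples M l +>\<^bsub>M\<^esub> (c \<odot>\<^bsub>component_space M gr (int d)\<^esub> x) =
      c \<odot>\<^bsub>component_space (quotient_module M (multiples M l)) (quotient_grading M (multiples M l) gr) (int d)\<^esub>
      (multiples M l +>\<^bsub>M\<^esub> x)"
      by (simp add: component_space_def quotient_module_def)
  next
    show "multiples M l +>\<^bsub>M\<^esub> \<zero>\<^bsub>component_space M gr (int d)\<^esub> =
      \<zero>\<^bsub>component_space (quotient_module M (multiples M l)) (quotient_grading M (multiples M l) gr) (int d)\<^esub>"
      by (simp add: component_space_def quotient_module_def M.a_coset_add_zero N.a_subset)
  qed
qed

text \<open>The vectors of \<open>C\<close> lie in \<open>multiples M l\<close>, so they are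
  independent elements of the kernel of the coset map, and each of them costs the quotient one
  dimension.\<close>

lemma hilbert_function_quotient_le:
  assumes l: "l \<in> carrier (poly_ring n)"
    and fd: "vectorspace.fin_dim (class_ring :: 'k ring) (component_space M gr (int d))"
    and C: "C \<subseteq> gr (int d)" "C \<subseteq> multiples M l"
      "\<not> LinearCombinations.module.lin_dep (class_ring :: 'k ring) (component_space M gr (int d)) C"
  shows "hilbert_function (quotient_module M (multiples M l)) (quotient_grading M (multiples M l) gr) (int d)
    + card C \<le> hilbert_function M gr (int d)"
proof -
  interpret N: abelian_subgroup "multiples M l" M by (rule multiples_subgroup[OF l])
  have "multiples M l +>\<^bsub>M\<^esub> c = multiples M l" if "c \<in> C" for c
    using that C(2) N.a_rcos_const by blast
  then show ?thesis
    unfolding hilbert_function_def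
    by (intro linear_map.dim_surjective_image_le[OF quotient_component_linear_map[OF l] fd])
      (use C in \<open>simp_all add: component_space_def quotient_grading_def quotient_module_def\<close>)
qed

end

section \<open>Combining the rank bound with the quotient estimate\<close>

theorem corollary3p19:
  fixes M :: "('k::field mpoly, 'm) module" and gr :: "int \<Rightarrow> 'm set" and n d :: nat
  assumes "infinite (UNIV :: 'k set)"
    and "graded_module n M gr"
    and "finitely_generated n M"
    and "generated_in_degree_zero n M gr"
    and "int n + int d - 1 \<noteq> 0"
  shows "for_generic_linear_form n
    (\<lambda>l. real (hilbert_function (quotient_module M (multiples M l))
                 (quotient_grading M (multiples M l) gr) (int d))
       \<le> (real n - 1) / (real n + real d - 1) * real (hilbert_function M gr (int d)))"
proof -
  interpret graded_module n M gr by fact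
  let ?H = "hilbert_function M gr (int d)"
  let ?Q = "\<lambda>l. hilbert_function (quotient_module M (multiples M l)) (quotient_grading M (multiples M l) gr) (int d)"
  note fd = component_fin_dim[OF assms(1,3,4), of d]
  obtain f l0 r where f: "f \<in> carrier (poly_ring n)" "l0 \<in> homogeneous_part n 1"
      "eval_poly_at (linear_form_coeffs l0) f \<noteq> 0"
    and r: "d * ?H \<le> (n + d - 1) * r"
    and C: "\<And>l. l \<in> homogeneous_part n 1 \<Longrightarrow> eval_poly_at (linear_form_coeffs l) f \<noteq> 0 \<Longrightarrow> ?Q l + r \<le> ?H"
  proof (cases "d = 0")
    \<comment> \<open>In degree 0 the constant polynomial 1 and \<open>r = 0\<close> suffice:
      passing to the quotient does not raise the dimension.\<close>
    case True
    have one: "const_poly 1 \<in> carrier (poly_ring n)" by (rule const_poly_carrier)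
    have "\<not> LinearCombinations.module.lin_dep (class_ring :: 'k ring) (component_space M gr (int d)) {}"
    proof -
      interpret V: vectorspace class_ring "component_space M gr (int d)" by (rule vectorspace_component)
      show ?thesis by (simp add: V.lin_dep_def)
    qed
    then have "?Q l + 0 \<le> ?H" if "l \<in> homogeneous_part n 1" for l
      using hilbert_function_quotient_le[OF homogeneous_part_carrier[OF that] fd, of "{}"] by simp
    moreover have "eval_poly_at a (const_poly (1::'k)) \<noteq> 0" for a
      by (simp add: const_poly_def eval_poly_at_def)
    \<comment> \<open>\<open>undefined\<close> is an arbitrary coefficient vector: the constant 1
      vanishes nowhere, so any linear form is a witness.\<close>
    ultimately show ?thesis
      using that[OF one linear_form_homogeneous, of undefined 0] True by simp
  next
    case False
    with assms(5) have "0 < d" "n + d \<noteq> 1" by auto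
    from generic_rank[OF assms(1,3,4) this] obtain f l0 r where
      *: "f \<in> carrier (poly_ring n)" "l0 \<in> homogeneous_part n 1" "eval_poly_at (linear_form_coeffs l0) f \<noteq> 0"
      "d * ?H \<le> (n + d - 1) * r"
      and C: "\<And>l. l \<in> homogeneous_part n 1 \<Longrightarrow> eval_poly_at (linear_form_coeffs l) f \<noteq> 0 \<Longrightarrow>
        \<exists>C \<subseteq> gr (int d). C \<subseteq> multiples M l \<and> card C = r \<and>
        \<not> LinearCombinations.module.lin_dep (class_ring :: 'k ring) (component_space M gr (int d)) C"
      unfolding hilbert_function_def by metis
    show ?thesis
    proof (rule that[OF *])
      fix l :: "'k mpoly"
      assume l: "l \<in> homogeneous_part n 1" "eval_poly_at (linear_form_coeffs l) f \<noteq> 0"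
      from C[OF l] show "?Q l + r \<le> ?H"
        using hilbert_function_quotient_le[OF homogeneous_part_carrier[OF l(1)] fd] by blast
    qed
  qed
  have "real (?Q l) \<le> (real n - 1) / (real n + real d - 1) * real ?H"
    if "l \<in> homogeneous_part n 1" "eval_poly_at (linear_form_coeffs l) f \<noteq> 0" for l
  proof (cases "n + d = 0")
    \<comment> \<open>For \<open>n = d = 0\<close> the real factor is
      \<open>(-1) / (-1) = 1\<close>, whereas the natural number \<open>n + d - 1\<close> truncates
      to 0; the estimate \<open>?Q l + r \<le> ?H\<close> is enough.\<close>
    case True
    then show ?thesis using C[OF that] by simp
  next
    case False
    \<comment> \<open>As \<open>n + d\<close> is positive, \<open>N\<close> agrees with the natural
      number \<open>n + d - 1\<close>; the numerator of the claim is
      \<open>N - real d\<close>.\<close>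
    define N where "N = real n + real d - 1"
    have N: "N > 0" using False assms(5) unfolding N_def by linarith
    have "real (d * ?H) \<le> real ((n + d - 1) * r)" using r by (simp only: of_nat_le_iff)
    then have "real d * real ?H \<le> N * real r"
      using False by (simp add: N_def of_nat_diff)
    \<comment> \<open>Scaling \<open>?Q l + r \<le> ?H\<close> by \<open>N\<close> allows
      \<open>r\<close> to be eliminated with the bound just shown.\<close>
    moreover have "N * real (?Q l) + N * real r \<le> N * real ?H"
      using C[OF that] N by (simp flip: of_nat_add distrib_left)
    ultimately have "real (?Q l) * N \<le> (N - real d) * real ?H"
      by (simp add: algebra_simps)
    then have "real (?Q l) \<le> (N - real d) * real ?H / N"
      by (simp only: pos_le_divide_eq[OF N])
    then show ?thesis by (simp add: N_def)
  qed
  \<comment> \<open>The open set is the nonvanishing locus of the single polynomial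
    \<open>f\<close>; it contains \<open>l0\<close>.\<close>
  then show ?thesis
    unfolding for_generic_linear_form_def zariski_open_linear_forms_def
    using f by (intro exI[of _ "{l \<in> homogeneous_part n 1. \<exists>f \<in> {f}. eval_poly_at (linear_form_coeffs l) f \<noteq> 0}"])
      (auto intro!: exI[of _ "{f}"])
qed

end
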